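(* Let $p\in\left(2+\frac4N,2+\frac8N\right)$, $\varepsilon>0$, and $$\omega(\varepsilon):=(p-2)\,\frac{N(p-2)-4}2\left(\frac{8-N(p-2)}2\right)^{-2}\|v\|_{L^2(\mathbb R^N)}^{-2}\,\varepsilon^{-1},$$ where $v\in H^2(\mathbb R^N)$ is an optimizer of the inequality $$\|u\|_{L^p(\mathbb R^N)}^p\leqslant C_{N,p}\|\Delta u\|_{L^2(\mathbb R^N)}^{\frac{N(p-2)-4}2}\|\nabla u\|_{L^2(\mathbb R^N)}^{\frac{8-N(p-2)}2}\|u\|_{L^2(\mathbb R^N)}^{p-2},\qquad u\in H^2(\mathbb R^N),$$ such that $\|\nabla v\|_{L^2(\mathbb R^N)}=\|\Delta v\|_{L^2(\mathbb R^N)}=1$. Then $u$ is an energy GSS for the critical mass $c_\varepsilon$ whose Lagrange multiplier is $\omega=\omega(\varepsilon)$ if and only if $u$ is an action GSS with $\omega=\omega(\varepsilon)$.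
   Context: $N\geqslant1$ is an integer. $C_{N,p}\in(0,\infty)$ is the best (smallest) constant in the inequality of the claim; an optimizer is a nonzero $u\in H^2(\mathbb R^N)$ for which equality holds. The critical mass is $$c_\varepsilon:=C_{N,p}^{-\frac2{p-2}}\left[\frac{2p}{N(p-2)-4}\right]^{\frac{N(p-2)-4}{2(p-2)}}\left[\frac{2p}{8-N(p-2)}\right]^{\frac{8-N(p-2)}{2(p-2)}}\varepsilon^{\frac{N(p-2)-4}{2(p-2)}}.$$ Energy GSS: for $c>0$ let $S_c:=\{u\in H^2(\mathbb R^N): \int_{\mathbb R^N}|u|^2\,dx=c\}$ and $$E_\varepsilon(u):=\frac\varepsilon2\int_{\mathbb R^N}|\Delta u|^2\,dx+\frac12\int_{\mathbb R^N}|\nabla u|^2\,dx-\frac1p\int_{\mathbb R^N}|u|^p\,dx,\qquad m_\varepsilon(c):=\inf_{u\in S_c}E_\varepsilon(u).$$ An energy GSS for the mass $c$ is a function $u\in S_c$ with $E_\varepsilon(u)=m_\varepsilon(c)$. Its Lagrange multiplier is the number $\omega$ such that $u$ weakly solves $\varepsilon\Delta^2u-\Delta u+\omega u=|u|^{p-2}u$ in $\mathbb R^N$. Action GSS: for $\omega>0$ let $I_\omega(u):=E_\varepsilon(u)+\frac\omega2\|u\|_{L^2(\mathbb R^N)}^2$ for $u\in H^2(\mathbb R^N)$, let $\mathcal N:=\{u\in H^2(\mathbb R^N)\setminus\{0\}:\langle I_\omega'(u),u\rangle=0\}$ where $\langle I_\omega'(u),u\rangle=\varepsilon\|\Delta u\|_2^2+\|\nabla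 u\|_2^2+\omega\|u\|_2^2-\|u\|_p^p$, and let $\sigma_\omega:=\inf_{u\in\mathcal N}I_\omega(u)$. An action GSS (with frequency $\omega$) is a function $u\in\mathcal N$ with $I_\omega(u)=\sigma_\omega$. *)

theory Defs
  imports "HOL-Analysis.Analysis"
begin

text \<open>
  Elements of Lebesgue and Sobolev spaces are represented by Borel functions; every class of
  Lebesgue measurable functions modulo null sets contains one. Functions are real-valued.
\<close>

definition in_Lp :: "real \<Rightarrow> (real ^ 'n \<Rightarrow> 'b::euclidean_space) \<Rightarrow> bool" where
  "in_Lp q f \<longleftrightarrow> f \<in> borel_measurable lborel \<and> integrable lborel (\<lambda>x. norm (f x) powr q)"

definition Lp_norm :: "real \<Rightarrow> (real ^ 'n \<Rightarrow> 'b::euclidean_space) \<Rightarrow> real" where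
  "Lp_norm q f = (\<integral>x. norm (f x) powr q \<partial>lborel) powr (1 / q)"

definition partial :: "'n \<Rightarrow> (real ^ 'n \<Rightarrow> real) \<Rightarrow> real ^ 'n \<Rightarrow> real" where
  "partial i f x = frechet_derivative f (at x) (axis i 1)"

primrec C_k :: "nat \<Rightarrow> (real ^ 'n \<Rightarrow> real) \<Rightarrow> bool" where
  "C_k 0 f \<longleftrightarrow> continuous_on UNIV f"
| "C_k (Suc k) f \<longleftrightarrow> (\<forall>x. f differentiable (at x)) \<and> (\<forall>i. C_k k (partial i f))"

definition test_function :: "(real ^ 'n \<Rightarrow> real) \<Rightarrow> bool" where
  "test_function \<phi> \<longleftrightarrow> (\<forall>k. C_k k \<phi>) \<and> compact (closure {x. \<phi> x \<noteq> 0})"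

definition has_weak_partial :: "'n \<Rightarrow> (real ^ 'n \<Rightarrow> real) \<Rightarrow> (real ^ 'n \<Rightarrow> real) \<Rightarrow> bool" where
  "has_weak_partial i f g \<longleftrightarrow> in_Lp 2 f \<and> in_Lp 2 g \<and>
     (\<forall>\<phi>. test_function \<phi> \<longrightarrow>
        (\<integral>x. f x * partial i \<phi> x \<partial>lborel) = - (\<integral>x. g x * \<phi> x \<partial>lborel))"

definition H2 :: "(real ^ 'n \<Rightarrow> real) set" where
  "H2 = {u. in_Lp 2 u \<and>
     (\<forall>i. \<exists>g. has_weak_partial i u g \<and> (\<forall>j. \<exists>h. has_weak_partial j g h))}"

text \<open>
  Weak derivatives are unique up to null sets, and everything below depends on them only up to
  null sets, so any choice of representative will do.
\<close>

definition wpartial :: "'n \<Rightarrow> (real ^ 'n \<Rightarrow> real) \<Rightarrow> real ^ 'n \<Rightarrow> real" where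
  "wpartial i f = (SOME g. has_weak_partial i f g)"

definition grad :: "(real ^ 'n \<Rightarrow> real) \<Rightarrow> real ^ 'n \<Rightarrow> real ^ 'n" where
  "grad u x = (\<chi> i. wpartial i u x)"

definition laplacian :: "(real ^ 'n \<Rightarrow> real) \<Rightarrow> real ^ 'n \<Rightarrow> real" where
  "laplacian u x = (\<Sum>i\<in>UNIV. wpartial i (wpartial i u) x)"

definition nonzero :: "(real ^ 'n \<Rightarrow> real) \<Rightarrow> bool" where
  "nonzero u \<longleftrightarrow> \<not> (AE x in lborel. u x = 0)"

definition GN_rhs :: "real \<Rightarrow> real \<Rightarrow> (real ^ 'n \<Rightarrow> real) \<Rightarrow> real" where
  "GN_rhs p C u =
     C * Lp_norm 2 (laplacian u) powr ((real CARD('n) * (p - 2) - 4) / 2)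
       * Lp_norm 2 (grad u) powr ((8 - real CARD('n) * (p - 2)) / 2)
       * Lp_norm 2 u powr (p - 2)"

text \<open>
  The conjunct \<open>in_Lp p u\<close> expresses that the left-hand side is finite: the Bochner
  integral of a non-integrable function is 0, so the inequality alone would hold trivially.
\<close>

definition GN_inequality :: "'n::finite itself \<Rightarrow> real \<Rightarrow> real \<Rightarrow> bool" where
  "GN_inequality TYPE('n) p C \<longleftrightarrow>
     (\<forall>u :: real ^ 'n \<Rightarrow> real. u \<in> H2 \<longrightarrow> in_Lp p u \<and> Lp_norm p u powr p \<le> GN_rhs p C u)"

definition GN_best_constant :: "'n::finite itself \<Rightarrow> real \<Rightarrow> real \<Rightarrow> bool" where
  "GN_best_constant TYPE('n) p C \<longleftrightarrow>
     0 < C \<and> GN_inequality TYPE('n) p C \<and> (\<forall>C'>0. GN_inequality TYPE('n) p C' \<longrightarrow> C \<le> C')"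

definition GN_optimizer :: "real \<Rightarrow> real \<Rightarrow> (real ^ 'n \<Rightarrow> real) \<Rightarrow> bool" where
  "GN_optimizer p C v \<longleftrightarrow> v \<in> H2 \<and> nonzero v \<and> Lp_norm p v powr p = GN_rhs p C v"

definition critical_mass :: "nat \<Rightarrow> real \<Rightarrow> real \<Rightarrow> real \<Rightarrow> real" where
  "critical_mass N p C \<epsilon> =
     C powr (- 2 / (p - 2))
     * (2 * p / (real N * (p - 2) - 4)) powr ((real N * (p - 2) - 4) / (2 * (p - 2)))
     * (2 * p / (8 - real N * (p - 2))) powr ((8 - real N * (p - 2)) / (2 * (p - 2)))
     * \<epsilon> powr ((real N * (p - 2) - 4) / (2 * (p - 2)))"

definition energy :: "real \<Rightarrow> real \<Rightarrow> (real ^ 'n \<Rightarrow> real) \<Rightarrow> real" where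
  "energy \<epsilon> p u =
     \<epsilon> / 2 * (\<integral>x. \<bar>laplacian u x\<bar>\<^sup>2 \<partial>lborel)
     + 1 / 2 * (\<integral>x. (norm (grad u x))\<^sup>2 \<partial>lborel)
     - 1 / p * (\<integral>x. \<bar>u x\<bar> powr p \<partial>lborel)"

definition mass_sphere :: "real \<Rightarrow> (real ^ 'n \<Rightarrow> real) set" where
  "mass_sphere c = {u \<in> H2. (\<integral>x. \<bar>u x\<bar>\<^sup>2 \<partial>lborel) = c}"

text \<open>
  The infima are taken in the extended reals, so that they are meaningful also for sets that are
  empty or not bounded below.
\<close>

definition min_energy :: "'n::finite itself \<Rightarrow> real \<Rightarrow> real \<Rightarrow> real \<Rightarrow> ereal" where
  "min_energy TYPE('n) \<epsilon> p c =
     (INF u \<in> (mass_sphere c :: (real ^ 'n \<Rightarrow> real) set). ereal (energy \<epsilon> p u))"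

definition energy_GSS :: "real \<Rightarrow> real \<Rightarrow> real \<Rightarrow> (real ^ 'n \<Rightarrow> real) \<Rightarrow> bool" where
  "energy_GSS \<epsilon> p c u \<longleftrightarrow>
     u \<in> mass_sphere c \<and> ereal (energy \<epsilon> p u) = min_energy TYPE('n) \<epsilon> p c"

text \<open>
  Weak solution in \<open>H2\<close> of
  \<open>\<epsilon> \<Delta>\<^sup>2 u - \<Delta> u + \<omega> u = \<bar>u\<bar> powr (p - 2) * u\<close>, tested against \<open>H2\<close>.
\<close>

definition lagrange_multiplier :: "real \<Rightarrow> real \<Rightarrow> real \<Rightarrow> (real ^ 'n \<Rightarrow> real) \<Rightarrow> bool" where
  "lagrange_multiplier \<epsilon> p \<omega> u \<longleftrightarrow> u \<in> H2 \<and>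
     (\<forall>\<phi>\<in>H2.
        \<epsilon> * (\<integral>x. laplacian u x * laplacian \<phi> x \<partial>lborel)
        + (\<integral>x. grad u x \<bullet> grad \<phi> x \<partial>lborel)
        + \<omega> * (\<integral>x. u x * \<phi> x \<partial>lborel)
        = (\<integral>x. \<bar>u x\<bar> powr (p - 2) * u x * \<phi> x \<partial>lborel))"

definition action :: "real \<Rightarrow> real \<Rightarrow> real \<Rightarrow> (real ^ 'n \<Rightarrow> real) \<Rightarrow> real" where
  "action \<epsilon> p \<omega> u = energy \<epsilon> p u + \<omega> / 2 * (Lp_norm 2 u)\<^sup>2"

definition nehari :: "real \<Rightarrow> real \<Rightarrow> real \<Rightarrow> (real ^ 'n \<Rightarrow> real) set" where
  "nehari \<epsilon> p \<omega> = {u \<in> H2. nonzero u \<and>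
     \<epsilon> * (Lp_norm 2 (laplacian u))\<^sup>2 + (Lp_norm 2 (grad u))\<^sup>2 + \<omega> * (Lp_norm 2 u)\<^sup>2
       - Lp_norm p u powr p = 0}"

definition min_action :: "'n::finite itself \<Rightarrow> real \<Rightarrow> real \<Rightarrow> real \<Rightarrow> ereal" where
  "min_action TYPE('n) \<epsilon> p \<omega> =
     (INF u \<in> (nehari \<epsilon> p \<omega> :: (real ^ 'n \<Rightarrow> real) set). ereal (action \<epsilon> p \<omega> u))"

definition action_GSS :: "real \<Rightarrow> real \<Rightarrow> real \<Rightarrow> (real ^ 'n \<Rightarrow> real) \<Rightarrow> bool" where
  "action_GSS \<epsilon> p \<omega> u \<longleftrightarrow>
     u \<in> nehari \<epsilon> p \<omega> \<and> ereal (action \<epsilon> p \<omega> u) = min_action TYPE('n) \<epsilon> p \<omega>"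

end

theory Submission
  imports Defs
begin

text \<open>
  Write \<open>X = \<epsilon> \<parallel>\<Delta>u\<parallel>\<^sup>2 + \<parallel>\<nabla>u\<parallel>\<^sup>2\<close>, \<open>M = \<parallel>u\<parallel>\<^sup>2\<close> and \<open>q = (p - 2) / 2\<close>. The interpolation inequality
  and the weighted arithmetic-geometric mean inequality give \<open>\<integral> \<bar>u\<bar> powr p \<le> D X M powr q\<close>, where
  \<open>D c powr q = p / 2\<close> for the critical mass \<open>c\<close>. Hence the energy is nonnegative on the sphere of
  mass \<open>c\<close>, and the action is at least \<open>\<omega> c / 2\<close> on the Nehari manifold for every \<open>\<omega> > 0\<close>, with
  equality only at mass \<open>c\<close>. A rescaling of the optimizer \<open>v\<close> attains both bounds for the given \<open>\<omega>\<close>,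
  so the minimal energy is 0 and the minimal action is \<open>\<omega> c / 2\<close>. An energy ground state with
  multiplier \<open>\<omega>\<close> lies on the Nehari manifold (test the equation with \<open>u\<close>) and has action
  \<open>\<omega> c / 2\<close>. Conversely an action ground state has mass \<open>c\<close> and energy 0, hence it minimises
  \<open>D X M powr q - \<integral> \<bar>u\<bar> powr p\<close> over the whole space, and the Euler--Lagrange equation of this
  functional is the equation with multiplier \<open>\<omega>\<close>.
\<close>

subsection \<open>Smooth bumps and the fundamental lemma of the calculus of variations\<close>

text \<open>For \<open>n = 0\<close> this is the classical smooth step, flat at 0. The factor
  \<open>1 / x ^ n\<close> makes the family closed under differentiation up to linear combinations,
  and \<open>c\<close> is a parameter so that the step can be sent to the indicator of the positive
  axis.\<close>

definition exp_step :: "nat \<Rightarrow> real \<Rightarrow> real \<Rightarrow> real" where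
  "exp_step n c x = (if 0 < x then exp (- c / x) / x ^ n else 0)"

lemma power_div_fact_le_exp:
  fixes y :: real
  assumes "0 \<le> y"
  shows "y ^ n / fact n \<le> exp y"
proof -
  have "(\<lambda>n. y ^ n / fact n) sums exp y"
    using exp_converges[of y] by (simp add: field_simps)
  then show ?thesis
    using sum_le_suminf[of "\<lambda>n. y ^ n / fact n" "{n}"] assms by (simp add: sums_iff)
qed

text \<open>The term of order \<open>n + 2\<close> of the exponential series beats
  \<open>x ^ n\<close> and leaves a quadratic bound, enough for the derivative at 0 to exist and
  vanish.\<close>

lemma exp_step_le_square:
  assumes "0 < c"
  shows "\<bar>exp_step n c x\<bar> \<le> fact (n + 2) / c ^ (n + 2) * x\<^sup>2"
proof (cases "0 < x")
  case True
  have "(c / x) ^ (n + 2) / fact (n + 2) \<le> exp (c / x)"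
    using True assms by (intro power_div_fact_le_exp) simp
  then have "c ^ (n + 2) \<le> exp (c / x) * fact (n + 2) * x ^ (n + 2)"
    using True by (simp add: power_divide divide_simps mult_ac)
  then have "exp (- c / x) / x ^ n \<le> fact (n + 2) / c ^ (n + 2) * x\<^sup>2"
    using True assms by (simp add: exp_minus divide_simps power_add power2_eq_square mult_ac)
  then show ?thesis using True by (simp add: exp_step_def)
qed (simp add: exp_step_def assms less_imp_le)

lemma exp_step_DERIV:
  assumes "0 < c"
  shows "(exp_step n c has_real_derivative
           c * exp_step (n + 2) c x - real n * exp_step (n + 1) c x) (at x)"
proof -
  consider "x > 0" | "x < 0" | "x = 0" by linarith
  then show ?thesis
  proof cases
    case 1
    have "((\<lambda>x. exp (- c / x) / x ^ n) has_real_derivative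
             c * (exp (- c / x) / x ^ (n + 2)) - real n * (exp (- c / x) / x ^ (n + 1))) (at x)"
    proof -
      have "((\<lambda>x. exp (- c / x)) has_real_derivative exp (- c / x) * (c / x\<^sup>2)) (at x)"
        using 1 by (auto intro!: derivative_eq_intros simp: power2_eq_square)
      from DERIV_divide[OF this DERIV_pow[of n x UNIV]] 1
      have "((\<lambda>x. exp (- c / x) / x ^ n) has_real_derivative
        (exp (- c / x) * (c / x\<^sup>2) * x ^ n - exp (- c / x) * (real n * x ^ (n - Suc 0))) / (x ^ n * x ^ n)) (at x)"
        by simp
      moreover have "(exp (- c / x) * (c / x\<^sup>2) * x ^ n - exp (- c / x) * (real n * x ^ (n - Suc 0))) / (x ^ n * x ^ n)
        = c * (exp (- c / x) / x ^ (n + 2)) - real n * (exp (- c / x) / x ^ (n + 1))"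
        using 1 by (cases n) (simp_all add: field_simps power2_eq_square)
      ultimately show ?thesis by simp
    qed
    then have "((\<lambda>x. exp (- c / x) / x ^ n) has_real_derivative
             c * exp_step (n + 2) c x - real n * exp_step (n + 1) c x) (at x)"
      using 1 by (simp add: exp_step_def)
    then show ?thesis
      by (rule has_field_derivative_transform_within_open[where S = "{0<..}"])
         (use 1 in \<open>auto simp: exp_step_def\<close>)
  next
    case 2
    have "((\<lambda>x. 0) has_real_derivative 0) (at x)" by simp
    then have "(exp_step n c has_real_derivative 0) (at x)"
      by (rule has_field_derivative_transform_within_open[where S = "{..<0}"])
         (use 2 in \<open>auto simp: exp_step_def\<close>)
    then show ?thesis using 2 by (simp add: exp_step_def)
  next
    case 3
    let ?K = "fact (n + 2) / c ^ (n + 2) :: real"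
    \<comment> \<open>The quadratic bound controls the difference quotient at 0 by a multiple of
      \<open>\<bar>h\<bar>\<close>; both terms of the claimed derivative are 0 there by
      definition.\<close>
    have "((\<lambda>h. exp_step n c h / h) \<longlongrightarrow> 0) (at 0)"
    proof (rule Lim_null_comparison)
      show "\<forall>\<^sub>F h in at 0. norm (exp_step n c h / h) \<le> ?K * \<bar>h\<bar>"
      proof (rule eventually_at_filter[THEN iffD2], rule always_eventually, clarify)
        fix h :: real assume "h \<noteq> 0"
        then show "norm (exp_step n c h / h) \<le> ?K * \<bar>h\<bar>"
          using exp_step_le_square[OF assms, of n h]
          by (simp add: abs_divide pos_divide_le_eq power2_eq_square abs_mult mult.assoc)
      qed
      show "((\<lambda>h. ?K * \<bar>h\<bar>) \<longlongrightarrow> 0) (at 0)"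
        by (rule tendsto_eq_intros refl | simp)+
    qed
    then show ?thesis by (simp add: 3 DERIV_def exp_step_def)
  qed
qed

lemma partial_eq: "(f has_derivative f') (at x) \<Longrightarrow> partial i f x = f' (axis i 1)"
  by (simp add: partial_def frechet_derivative_at[symmetric])

text \<open>An algebra generated by one-dimensional steps and stable under partial derivatives, so
  that smoothness of every order follows by one induction, without formulas for higher
  derivatives.\<close>

inductive_set bump_algebra :: "(real ^ 'n \<Rightarrow> real) set" where
  const: "(\<lambda>_. a) \<in> bump_algebra"
| step: "0 < c \<Longrightarrow> (\<lambda>x. exp_step n c (s * x $ i + a)) \<in> bump_algebra"
| add: "f \<in> bump_algebra \<Longrightarrow> g \<in> bump_algebra \<Longrightarrow> (\<lambda>x. f x + g x) \<in> bump_algebra"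
| mult: "f \<in> bump_algebra \<Longrightarrow> g \<in> bump_algebra \<Longrightarrow> (\<lambda>x. f x * g x) \<in> bump_algebra"

lemma bump_algebra_partial:
  assumes "f \<in> bump_algebra"
  shows "(\<forall>x. f differentiable (at x)) \<and> (\<forall>i. partial i f \<in> bump_algebra)"
  using assms
proof induction
  case (const a)
  have "partial i (\<lambda>_ :: real ^ 'a. a) = (\<lambda>_. 0)" for i
    by (intro ext) (rule partial_eq[THEN trans], auto intro!: derivative_eq_intros)
  then show ?case using bump_algebra.const by simp
next
  case (step c n s i a)
  have der: "((\<lambda>x :: real ^ 'a. exp_step n c (s * x $ i + a)) has_derivative
      (\<lambda>h. (c * exp_step (n + 2) c (s * x $ i + a) - real n * exp_step (n + 1) c (s * x $ i + a)) * (s * h $ i))) (at x)" for x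
  proof -
    have "((\<lambda>x :: real ^ 'a. s * x $ i + a) has_derivative (\<lambda>h. s * h $ i)) (at x)"
      by (auto intro!: derivative_eq_intros bounded_linear.has_derivative[OF bounded_linear_vec_nth])
    from has_derivative_compose[OF this exp_step_DERIV[OF step, of n, unfolded has_field_derivative_def]]
    show ?thesis by simp
  qed
  \<comment> \<open>\<open>axis j 1 $ i\<close> is 1 or 0 according to whether \<open>i = j\<close>,
    so one formula with constant coefficients treats both cases.\<close>
  have "partial j (\<lambda>x :: real ^ 'a. exp_step n c (s * x $ i + a)) =
      (\<lambda>x. (s * axis j 1 $ i * c) * exp_step (n + 2) c (s * x $ i + a)
         + (- real n * s * axis j 1 $ i) * exp_step (n + 1) c (s * x $ i + a))" for j
    by (intro ext) (simp only: partial_eq[OF der], simp add: algebra_simps)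
  then have "partial j (\<lambda>x :: real ^ 'a. exp_step n c (s * x $ i + a)) \<in> bump_algebra" for j
    by (simp only:) (intro bump_algebra.intros step)
  then show ?case using der by (auto simp: differentiable_def)
next
  case (add f g)
  have "partial j (\<lambda>x. f x + g x) = (\<lambda>x. partial j f x + partial j g x)" for j
  proof
    fix x
    have "((\<lambda>x. f x + g x) has_derivative (\<lambda>h. frechet_derivative f (at x) h + frechet_derivative g (at x) h)) (at x)"
      using add by (intro has_derivative_add) (auto simp: frechet_derivative_works)
    from partial_eq[OF this] show "partial j (\<lambda>x. f x + g x) x = partial j f x + partial j g x"
      by (simp add: partial_def)
  qed
  then show ?case using add by (auto intro: bump_algebra.add)
next
  case (mult f g)
  have "((\<lambda>x. f x * g x) has_derivative (\<lambda>h. f x * frechet_derivative g (at x) h + frechet_derivative f (at x) h * g x)) (at x)" for x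
    using mult by (intro has_derivative_mult) (auto simp: frechet_derivative_works)
  from partial_eq[OF this] have "partial j (\<lambda>x. f x * g x) = (\<lambda>x. f x * partial j g x + partial j f x * g x)" for j
    by (intro ext) (simp add: partial_def)
  moreover have "(\<lambda>x. f x * partial j g x + partial j f x * g x) \<in> bump_algebra" for j
    using mult by (intro bump_algebra.add bump_algebra.mult) auto
  ultimately show ?case using mult by auto
qed

lemma C_k_continuous: "C_k k f \<Longrightarrow> continuous_on UNIV f"
  by (cases k) (auto intro!: continuous_at_imp_continuous_on differentiable_imp_continuous_within)

lemma bump_algebra_C_k: "f \<in> bump_algebra \<Longrightarrow> C_k k f"
proof (induction k arbitrary: f)
  case 0
  then show ?case using bump_algebra_partial[OF 0]
    by (auto intro!: continuous_at_imp_continuous_on differentiable_imp_continuous_within)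
next
  case (Suc k)
  then show ?case using bump_algebra_partial[OF Suc.prems] by simp
qed

lemma bump_algebra_prod:
  assumes "finite I" "\<And>i. i \<in> I \<Longrightarrow> f i \<in> bump_algebra"
  shows "(\<lambda>x. \<Prod>i\<in>I. f i x) \<in> bump_algebra"
  using assms by (induction I) (auto intro: bump_algebra.intros)

text \<open>Two steps per coordinate, one for each face, so that the product is positive exactly
  inside the open box.\<close>

definition box_bump :: "real \<Rightarrow> real ^ 'n \<Rightarrow> real ^ 'n \<Rightarrow> real ^ 'n \<Rightarrow> real" where
  "box_bump c a b x = (\<Prod>i\<in>UNIV. exp_step 0 c (x $ i - a $ i) * exp_step 0 c (b $ i - x $ i))"

lemma box_bump_eq_0: "x \<notin> box a b \<Longrightarrow> box_bump c a b x = 0"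
  by (auto simp: box_bump_def mem_box_cart exp_step_def)

lemma test_function_box_bump:
  assumes "0 < c"
  shows "test_function (box_bump c a b)"
proof -
  \<comment> \<open>The arguments are put into the form \<open>s * x $ i + a\<close>, with
    \<open>s\<close> equal to 1 or -1, that the rule \<open>step\<close> admits.\<close>
  have "(\<lambda>x. \<Prod>i\<in>UNIV. exp_step 0 c (1 * x $ i + - a $ i) * exp_step 0 c ((-1) * x $ i + b $ i)) \<in> bump_algebra"
    by (intro bump_algebra_prod bump_algebra.intros assms finite)
  then have "box_bump c a b \<in> bump_algebra"
    by (simp add: box_bump_def[abs_def])
  moreover have "{x. box_bump c a b x \<noteq> 0} \<subseteq> cbox a b"
    using box_bump_eq_0 box_subset_cbox by blast
  then have "compact (closure {x. box_bump c a b x \<noteq> 0})"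
    by (meson bounded_cbox bounded_subset compact_closure)
  ultimately show ?thesis by (simp add: test_function_def bump_algebra_C_k)
qed

lemma box_bump_le_indicator:
  assumes "0 < c"
  shows "\<bar>box_bump c a b x\<bar> \<le> indicator (box a b) x"
proof (cases "x \<in> box a b")
  case True
  have *: "\<bar>exp_step 0 c y\<bar> \<le> 1" for y using assms by (simp add: exp_step_def)
  have "\<bar>box_bump c a b x\<bar> = (\<Prod>i\<in>UNIV. \<bar>exp_step 0 c (x $ i - a $ i)\<bar> * \<bar>exp_step 0 c (b $ i - x $ i)\<bar>)"
    by (simp add: box_bump_def abs_prod abs_mult)
  also have "\<dots> \<le> 1" using * by (intro prod_le_1) (auto intro!: mult_le_one)
  finally show ?thesis using True by simp
qed (simp add: box_bump_eq_0)

text \<open>Inside the box every factor is \<open>exp (- c / y)\<close> with a fixed positive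
  \<open>y\<close> and tends to 1 as \<open>c\<close> tends to 0. \<open>Suc k\<close> keeps
  \<open>c\<close> positive for \<open>k = 0\<close> as well.\<close>

lemma box_bump_tendsto:
  "(\<lambda>k. box_bump (1 / Suc k) a b x) \<longlonglongrightarrow> indicator (box a b) x"
proof (cases "x \<in> box a b")
  case True
  have lim: "(\<lambda>k. exp_step 0 (1 / Suc k) y) \<longlonglongrightarrow> 1" if "0 < y" for y
  proof -
    have "(\<lambda>k. exp (- (1 / real (Suc k)) / y)) \<longlonglongrightarrow> exp (- 0 / y)"
      by (intro tendsto_intros LIMSEQ_Suc[OF lim_1_over_n]) (use that in auto)
    then show ?thesis using that by (simp add: exp_step_def)
  qed
  have "(\<lambda>k. box_bump (1 / Suc k) a b x) \<longlonglongrightarrow> (\<Prod>i\<in>(UNIV :: 'a set). 1 * 1)"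
    unfolding box_bump_def
    by (intro tendsto_prod tendsto_mult lim) (use True in \<open>auto simp: mem_box_cart\<close>)
  then show ?thesis using True by simp
qed (simp add: box_bump_eq_0)

section \<open>Square-integrable functions and the fundamental lemma\<close>

lemma in_L2_iff:
  "in_Lp 2 f \<longleftrightarrow> f \<in> borel_measurable lborel \<and> integrable lborel (\<lambda>x. (norm (f x))\<^sup>2)"
  by (simp add: in_Lp_def)

lemma L2_mult_integrable:
  fixes f g :: "real ^ 'n \<Rightarrow> real"
  assumes "in_Lp 2 f" "in_Lp 2 g"
  shows "integrable lborel (\<lambda>x. f x * g x)"
proof (rule Bochner_Integration.integrable_bound)
  show "integrable lborel (\<lambda>x. (f x)\<^sup>2 + (g x)\<^sup>2)"
    using assms by (auto simp: in_L2_iff)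
  have "norm (f x * g x) \<le> norm ((f x)\<^sup>2 + (g x)\<^sup>2)" for x
  proof -
    have "2 * (\<bar>f x\<bar> * \<bar>g x\<bar>) \<le> (f x)\<^sup>2 + (g x)\<^sup>2" and "0 \<le> \<bar>f x\<bar> * \<bar>g x\<bar>"
      using sum_squares_bound[of "\<bar>f x\<bar>" "\<bar>g x\<bar>"] by (simp_all add: mult.assoc)
    then have "\<bar>f x\<bar> * \<bar>g x\<bar> \<le> (f x)\<^sup>2 + (g x)\<^sup>2" by linarith
    then show ?thesis by (simp add: abs_mult)
  qed
  then show "AE x in lborel. norm (f x * g x) \<le> norm ((f x)\<^sup>2 + (g x)\<^sup>2)" by simp
qed (use assms in \<open>auto simp: in_L2_iff\<close>)

text \<open>The positive and the negative part of \<open>f\<close> are densities of two measures.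
  These agree and are finite on open boxes, an intersection-stable generator of the Borel sets that
  exhausts the space. Hence they are equal, and densities are unique almost everywhere.\<close>

lemma AE_eq_0_if_box_integrals_eq_0:
  fixes f :: "'a::euclidean_space \<Rightarrow> real"
  assumes [measurable]: "f \<in> borel_measurable lborel"
    and int: "\<And>a b. integrable lborel (\<lambda>x. f x * indicator (box a b) x)"
    and zero: "\<And>a b. (\<integral>x. f x * indicator (box a b) x \<partial>lborel) = 0"
  shows "AE x in lborel. f x = 0"
proof -
  \<comment> \<open>\<open>ennreal\<close> maps negative numbers to 0, so these densities are the
    two parts of \<open>f\<close>.\<close>
  let ?P = "density lborel (\<lambda>x. ennreal (f x))" and ?Q = "density lborel (\<lambda>x. ennreal (- f x))"
  have fin: "emeasure ?P (box a b) < \<infinity>" and eq: "emeasure ?P (box a b) = emeasure ?Q (box a b)" for a b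
  proof -
    let ?g = "\<lambda>x. f x * indicator (box a b) x"
    have P: "emeasure ?P (box a b) = (\<integral>\<^sup>+x. ennreal (?g x) \<partial>lborel)"
      by (subst emeasure_density) (auto intro!: nn_integral_cong split: split_indicator)
    have Q: "emeasure ?Q (box a b) = (\<integral>\<^sup>+x. ennreal (- ?g x) \<partial>lborel)"
      by (subst emeasure_density) (auto intro!: nn_integral_cong split: split_indicator)
    from int[of a b] have fP: "(\<integral>\<^sup>+x. ennreal (?g x) \<partial>lborel) \<noteq> \<infinity>"
      and fQ: "(\<integral>\<^sup>+x. ennreal (- ?g x) \<partial>lborel) \<noteq> \<infinity>"
      by (auto simp: real_integrable_def)
    show "emeasure ?P (box a b) < \<infinity>" using P fP by (simp add: top.not_eq_extremum)
    \<comment> \<open>The integral of \<open>?g\<close> is the difference of these two numbers;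
      finiteness allows the passage back to extended values.\<close>
    have "enn2real (\<integral>\<^sup>+x. ennreal (?g x) \<partial>lborel) = enn2real (\<integral>\<^sup>+x. ennreal (- ?g x) \<partial>lborel)"
      using zero[of a b] int[of a b] by (simp add: real_lebesgue_integral_def)
    then show "emeasure ?P (box a b) = emeasure ?Q (box a b)"
      unfolding P Q using fP fQ
      by (subst (1 2) ennreal_enn2real[symmetric]) (simp_all add: top.not_eq_extremum)
  qed
  have "?P = ?Q"
  proof (rule measure_eqI_generator_eq)
    let ?E = "range (\<lambda>(a, b). box a b::'a set)"
    show "Int_stable ?E" by (auto simp: Int_stable_def box_Int_box)
    show "?E \<subseteq> Pow UNIV" "sets ?P = sigma_sets UNIV ?E" "sets ?Q = sigma_sets UNIV ?E"
      by (simp_all add: borel_eq_box)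
    let ?A = "\<lambda>n::nat. box (- (real n *\<^sub>R One)) (real n *\<^sub>R One) :: 'a set"
    show "range ?A \<subseteq> ?E" "(\<Union>i. ?A i) = UNIV" unfolding UN_box_eq_UNIV by auto
    show "emeasure ?P (?A i) \<noteq> \<infinity>" for i using fin by (simp add: less_top)
    show "emeasure ?P X = emeasure ?Q X" if "X \<in> ?E" for X using that eq by auto
  qed
  then have "AE x in lborel. ennreal (f x) = ennreal (- f x)"
    by (intro sigma_finite_measure.density_unique[OF sigma_finite_lborel]) auto
  then show ?thesis
  proof eventually_elim
    case (elim x)
    \<comment> \<open>Whatever the sign of \<open>f x\<close>, one of the two truncations is 0,
      hence so is the other.\<close>
    show "f x = 0"
    proof (cases "0 \<le> f x")
      case True
      with elim have "ennreal (f x) = 0" by (simp add: ennreal_neg)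
      with True show ?thesis by (simp add: ennreal_eq_0_iff)
    next
      case False
      with elim have "ennreal (- f x) = 0" by (simp add: ennreal_neg)
      with False show ?thesis by (simp add: ennreal_eq_0_iff)
    qed
  qed
qed

lemma in_L2_indicator_box: "in_Lp 2 (indicator (box a b) :: real ^ 'n \<Rightarrow> real)"
proof -
  have "(\<lambda>x. (norm (indicator (box a b) x :: real))\<^sup>2) = (indicator (box a b) :: real ^ 'n \<Rightarrow> real)"
    by (auto split: split_indicator)
  moreover have "integrable lborel (indicator (box a b) :: real ^ 'n \<Rightarrow> real)"
    using emeasure_lborel_box_finite[of a b] by (intro integrable_real_indicator) (auto simp: top.not_eq_extremum)
  ultimately show ?thesis by (simp add: in_L2_iff)
qed

text \<open>Testing with box bumps and letting their parameter tend to 0 shows that \<open>f\<close>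
  has integral 0 over every box; the indicator of the box dominates the bumps.\<close>

theorem fundamental_lemma_calculus_of_variations:
  fixes f :: "real ^ 'n \<Rightarrow> real"
  assumes f: "in_Lp 2 f" and zero: "\<And>\<phi>. test_function \<phi> \<Longrightarrow> (\<integral>x. f x * \<phi> x \<partial>lborel) = 0"
  shows "AE x in lborel. f x = 0"
proof (rule AE_eq_0_if_box_integrals_eq_0)
  show fm[measurable]: "f \<in> borel_measurable lborel" using f by (simp add: in_L2_iff)
  show int: "integrable lborel (\<lambda>x. f x * indicator (box a b) x)" for a b
    by (rule L2_mult_integrable[OF f in_L2_indicator_box])
  show "(\<integral>x. f x * indicator (box a b) x \<partial>lborel) = 0" for a b
  proof -
    have [measurable]: "box_bump (1 / Suc k) a b \<in> borel_measurable lborel" for k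
      using test_function_box_bump[of "1 / Suc k" a b] C_k_continuous
      by (auto simp: test_function_def intro!: borel_measurable_continuous_onI)
    have "(\<lambda>k. \<integral>x. f x * box_bump (1 / Suc k) a b x \<partial>lborel) \<longlonglongrightarrow> (\<integral>x. f x * indicator (box a b) x \<partial>lborel)"
    proof (rule integral_dominated_convergence)
      show "integrable lborel (\<lambda>x. \<bar>f x * indicator (box a b) x\<bar>)" using int by auto
      show "AE x in lborel. (\<lambda>k. f x * box_bump (1 / Suc k) a b x) \<longlonglongrightarrow> f x * indicator (box a b) x"
        by (intro AE_I2 tendsto_intros box_bump_tendsto)
      show "AE x in lborel. norm (f x * box_bump (1 / Suc k) a b x) \<le> \<bar>f x * indicator (box a b) x\<bar>" for k
        using box_bump_le_indicator[of "1 / Suc k" a b] by (auto simp: abs_mult intro!: mult_left_mono)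
    qed measurable
    moreover have "(\<integral>x. f x * box_bump (1 / Suc k) a b x \<partial>lborel) = 0" for k
      by (intro zero test_function_box_bump) simp
    ultimately show ?thesis by (simp add: LIMSEQ_const_iff)
  qed
qed

subsection \<open>Weak derivatives\<close>

lemma in_L2_measurable: "in_Lp 2 f \<Longrightarrow> f \<in> borel_measurable borel"
  by (simp add: in_L2_iff)

lemma in_L2_cong_AE:
  assumes "in_Lp 2 f" "AE x in lborel. f x = g x" "g \<in> borel_measurable borel"
  shows "in_Lp 2 g"
proof -
  have "integrable lborel (\<lambda>x. (norm (f x))\<^sup>2) \<longleftrightarrow> integrable lborel (\<lambda>x. (norm (g x))\<^sup>2)"
    using assms by (intro integrable_cong_AE) (auto simp: in_L2_iff)
  then show ?thesis using assms by (simp add: in_L2_iff)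
qed

lemma in_L2_add:
  fixes f g :: "real ^ 'n \<Rightarrow> real"
  assumes "in_Lp 2 f" "in_Lp 2 g"
  shows "in_Lp 2 (\<lambda>x. f x + g x)"
proof -
  have "(\<lambda>x. (norm (f x + g x))\<^sup>2) = (\<lambda>x. (norm (f x))\<^sup>2 + (norm (g x))\<^sup>2 + 2 * (f x * g x))"
    by (simp add: power2_sum algebra_simps)
  then show ?thesis using assms L2_mult_integrable[OF assms] by (auto simp: in_L2_iff)
qed

lemma in_L2_cmult:
  fixes f :: "real ^ 'n \<Rightarrow> real"
  shows "in_Lp 2 f \<Longrightarrow> in_Lp 2 (\<lambda>x. c * f x)"
  by (auto simp: in_L2_iff power_mult_distrib abs_mult)

lemma in_L2_sum:
  fixes f :: "'i \<Rightarrow> real ^ 'n \<Rightarrow> real"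
  assumes "finite I" "\<And>i. i \<in> I \<Longrightarrow> in_Lp 2 (f i)"
  shows "in_Lp 2 (\<lambda>x. \<Sum>i\<in>I. f i x)"
  using assms by (induction I) (auto intro: in_L2_add simp: in_L2_iff[of "\<lambda>_. 0"])

lemma in_L2_vec:
  fixes f :: "'m::finite \<Rightarrow> real ^ 'n \<Rightarrow> real"
  assumes "\<And>i. in_Lp 2 (f i)"
  shows "in_Lp 2 (\<lambda>x. \<chi> i. f i x)"
proof -
  have "(\<lambda>x. (norm (\<chi> i. f i x))\<^sup>2) = (\<lambda>x. \<Sum>i\<in>UNIV. (norm (f i x))\<^sup>2)"
    by (simp add: norm_vec_def L2_set_def sum_nonneg)
  moreover have "(\<lambda>x. \<chi> i. f i x) \<in> borel_measurable borel"
    using assms by (subst borel_measurable_euclidean_space) (auto simp: in_L2_iff Basis_vec_def inner_axis)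
  ultimately show ?thesis using assms by (auto simp: in_L2_iff)
qed

lemma test_function_in_L2:
  assumes "test_function \<phi>"
  shows "in_Lp 2 \<phi>"
proof -
  let ?K = "closure {x. \<phi> x \<noteq> 0}"
  have cont: "continuous_on UNIV \<phi>" using assms C_k_continuous[of 0 \<phi>] by (auto simp: test_function_def)
  have "integrable lborel (\<lambda>x. indicator ?K x *\<^sub>R (\<phi> x)\<^sup>2)"
    using assms by (intro borel_integrable_compact continuous_intros continuous_on_subset[OF cont])
      (auto simp: test_function_def)
  moreover have "(\<lambda>x. indicator ?K x *\<^sub>R (\<phi> x)\<^sup>2) = (\<lambda>x. (\<phi> x)\<^sup>2)"
    using closure_subset[of "{x. \<phi> x \<noteq> 0}"] by (auto simp: fun_eq_iff split: split_indicator)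
  ultimately show ?thesis
    using cont by (simp add: in_L2_iff borel_measurable_continuous_onI)
qed

lemma test_function_partial:
  assumes "test_function \<phi>"
  shows "test_function (partial i \<phi>)"
proof -
  let ?K = "closure {x. \<phi> x \<noteq> 0}"
  \<comment> \<open>Off the closed support the function vanishes on a whole neighbourhood.\<close>
  have "partial i \<phi> x = 0" if "x \<notin> ?K" for x
  proof -
    have "((\<lambda>_. 0 :: real) has_derivative (\<lambda>_. 0)) (at x)" by simp
    then have "(\<phi> has_derivative (\<lambda>_. 0)) (at x)"
      by (rule has_derivative_transform_within_open[where s = "- ?K"])
         (use that closure_subset[of "{x. \<phi> x \<noteq> 0}"] in auto)
    from partial_eq[OF this] show ?thesis .
  qed
  then have "{x. partial i \<phi> x \<noteq> 0} \<subseteq> ?K" by blast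
  moreover have "bounded ?K" using assms compact_imp_bounded by (auto simp: test_function_def)
  ultimately have "compact (closure {x. partial i \<phi> x \<noteq> 0})"
    using bounded_subset compact_closure by blast
  moreover have "C_k k (partial i \<phi>)" for k
    using assms unfolding test_function_def by (meson C_k.simps(2))
  ultimately show ?thesis by (simp add: test_function_def)
qed

lemmas test_function_partial_in_L2 = test_function_in_L2[OF test_function_partial]

text \<open>The difference of two weak derivatives is orthogonal to all test functions. This is what
  makes the choice in \<open>wpartial\<close> harmless.\<close>

lemma has_weak_partial_unique:
  assumes "has_weak_partial i f g" "has_weak_partial i f h"
  shows "AE x in lborel. g x = h x"
proof -
  have gh: "in_Lp 2 g" "in_Lp 2 h" using assms by (auto simp: has_weak_partial_def)
  have "AE x in lborel. g x + (-1) * h x = 0"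
  proof (rule fundamental_lemma_calculus_of_variations)
    show "in_Lp 2 (\<lambda>x. g x + (-1) * h x)" by (intro in_L2_add in_L2_cmult gh)
    fix \<phi> :: "real ^ 'a \<Rightarrow> real" assume t: "test_function \<phi>"
    then have "(\<integral>x. g x * \<phi> x \<partial>lborel) = (\<integral>x. h x * \<phi> x \<partial>lborel)"
      using assms by (simp add: has_weak_partial_def)
    then show "(\<integral>x. (g x + (-1) * h x) * \<phi> x \<partial>lborel) = 0"
      using L2_mult_integrable[OF gh(1) test_function_in_L2[OF t]]
        L2_mult_integrable[OF gh(2) test_function_in_L2[OF t]]
      by (simp add: left_diff_distrib)
  qed
  then show ?thesis by simp
qed

lemma has_weak_partial_cong_AE:
  assumes "has_weak_partial i f g" "AE x in lborel. f x = f' x" "f' \<in> borel_measurable borel"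
  shows "has_weak_partial i f' g"
proof -
  have "(\<integral>x. f x * partial i \<phi> x \<partial>lborel) = (\<integral>x. f' x * partial i \<phi> x \<partial>lborel)"
    if "test_function \<phi>" for \<phi>
    using assms in_L2_measurable[OF test_function_partial_in_L2[OF that, of i]]
    by (intro integral_cong_AE) (auto simp: has_weak_partial_def in_L2_iff)
  then show ?thesis
    using assms in_L2_cong_AE[OF _ assms(2,3)] by (auto simp: has_weak_partial_def)
qed

lemma has_weak_partial_add:
  assumes "has_weak_partial i f g" "has_weak_partial i f' g'"
  shows "has_weak_partial i (\<lambda>x. f x + f' x) (\<lambda>x. g x + g' x)"
proof -
  have L2: "in_Lp 2 f" "in_Lp 2 g" "in_Lp 2 f'" "in_Lp 2 g'"
    using assms by (auto simp: has_weak_partial_def)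
  have "(\<integral>x. (f x + f' x) * partial i \<phi> x \<partial>lborel) = - (\<integral>x. (g x + g' x) * \<phi> x \<partial>lborel)"
    if t: "test_function \<phi>" for \<phi>
    using assms t L2[THEN L2_mult_integrable, OF test_function_in_L2[OF t]]
      L2[THEN L2_mult_integrable, OF test_function_partial_in_L2[OF t, of i]]
    by (simp add: has_weak_partial_def distrib_right)
  then show ?thesis by (simp add: has_weak_partial_def in_L2_add L2)
qed

lemma has_weak_partial_cmult:
  "has_weak_partial i f g \<Longrightarrow> has_weak_partial i (\<lambda>x. c * f x) (\<lambda>x. c * g x)"
  by (simp add: has_weak_partial_def in_L2_cmult mult.assoc)

lemma has_weak_partial_wpartial:
  "has_weak_partial i f g \<Longrightarrow> has_weak_partial i f (wpartial i f)"
  unfolding wpartial_def by (rule someI[of "has_weak_partial i f"])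

lemma wpartial_AE_eq:
  "has_weak_partial i f g \<Longrightarrow> AE x in lborel. wpartial i f x = g x"
  using has_weak_partial_unique has_weak_partial_wpartial by blast

lemma H2_in_L2: "u \<in> H2 \<Longrightarrow> in_Lp 2 u"
  by (simp add: H2_def)

text \<open>\<open>H2\<close> asks for second derivatives of some representative of the first ones;
  uniqueness carries them over to the representative chosen by \<open>wpartial\<close>.\<close>

lemma H2_wpartial:
  assumes "u \<in> H2"
  shows "has_weak_partial i u (wpartial i u)"
    and "has_weak_partial j (wpartial i u) (wpartial j (wpartial i u))"
proof -
  obtain g h where g: "has_weak_partial i u g" "has_weak_partial j g h"
    using assms unfolding H2_def by blast
  from has_weak_partial_wpartial[OF g(1)] show w: "has_weak_partial i u (wpartial i u)" .
  have "has_weak_partial j (wpartial i u) h"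
    using has_weak_partial_cong_AE[OF g(2) has_weak_partial_unique[OF g(1) w]] w
    by (simp add: has_weak_partial_def in_L2_iff)
  from has_weak_partial_wpartial[OF this]
  show "has_weak_partial j (wpartial i u) (wpartial j (wpartial i u))" .
qed

text \<open>Replaces the arbitrary choice behind \<open>wpartial\<close> by any explicit family of
  weak derivatives, as needed for linear combinations and dilations.\<close>

lemma H2_I:
  assumes g: "\<And>i. has_weak_partial i u (g i)" and h: "\<And>i j. has_weak_partial j (g i) (h i j)"
  shows "u \<in> H2"
    and "AE x in lborel. grad u x = (\<chi> i. g i x)"
    and "AE x in lborel. laplacian u x = (\<Sum>i\<in>UNIV. h i i x)"
proof -
  have "in_Lp 2 u" using g by (simp add: has_weak_partial_def)
  then show u: "u \<in> H2"
    unfolding H2_def using g h by blast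
  have "AE x in lborel. \<forall>i. wpartial i u x = g i x"
    by (subst AE_all_countable) (use wpartial_AE_eq[OF g] in auto)
  then show "AE x in lborel. grad u x = (\<chi> i. g i x)"
    by eventually_elim (simp add: grad_def vec_eq_iff)
  have "has_weak_partial i (wpartial i u) (h i i)" for i
    using has_weak_partial_cong_AE[OF h has_weak_partial_unique[OF g H2_wpartial(1)[OF u]]]
      H2_wpartial(1)[OF u, of i]
    by (simp add: has_weak_partial_def in_L2_iff)
  then have "AE x in lborel. \<forall>i. wpartial i (wpartial i u) x = h i i x"
    by (subst AE_all_countable) (use wpartial_AE_eq in auto)
  then show "AE x in lborel. laplacian u x = (\<Sum>i\<in>UNIV. h i i x)"
    by eventually_elim (simp add: laplacian_def)
qed

lemma H2_grad_in_L2: "u \<in> H2 \<Longrightarrow> in_Lp 2 (grad u)"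
  using in_L2_vec[of "\<lambda>i. wpartial i u"] H2_wpartial(1)[of u]
  by (auto simp: grad_def[abs_def] has_weak_partial_def)

lemma H2_laplacian_in_L2: "u \<in> H2 \<Longrightarrow> in_Lp 2 (laplacian u)"
  using H2_wpartial(2)[of u]
  by (auto simp: laplacian_def[abs_def] has_weak_partial_def intro!: in_L2_sum)

lemma H2_lincomb:
  assumes u: "u \<in> H2" and v: "v \<in> H2"
  shows "(\<lambda>x. u x + t * v x) \<in> H2"
    and "AE x in lborel. grad (\<lambda>x. u x + t * v x) x = grad u x + t *\<^sub>R grad v x"
    and "AE x in lborel. laplacian (\<lambda>x. u x + t * v x) x = laplacian u x + t * laplacian v x"
proof -
  let ?g = "\<lambda>i x. wpartial i u x + t * wpartial i v x"
  let ?h = "\<lambda>i j x. wpartial j (wpartial i u) x + t * wpartial j (wpartial i v) x"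
  have g: "has_weak_partial i (\<lambda>x. u x + t * v x) (?g i)" for i
    by (intro has_weak_partial_add has_weak_partial_cmult H2_wpartial u v)
  have h: "has_weak_partial j (?g i) (?h i j)" for i j
    by (intro has_weak_partial_add has_weak_partial_cmult H2_wpartial u v)
  show "(\<lambda>x. u x + t * v x) \<in> H2" by (rule H2_I(1)[OF g h])
  show "AE x in lborel. grad (\<lambda>x. u x + t * v x) x = grad u x + t *\<^sub>R grad v x"
    using H2_I(2)[OF g h] by eventually_elim (simp add: grad_def vec_eq_iff)
  show "AE x in lborel. laplacian (\<lambda>x. u x + t * v x) x = laplacian u x + t * laplacian v x"
    using H2_I(3)[OF g h] by eventually_elim (simp add: laplacian_def sum.distrib sum_distrib_left)
qed

section \<open>Dilations of the variable\<close>

lemma lborel_eq_density_dilation: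
  assumes "0 < (l :: real)"
  shows "(lborel :: (real ^ 'n) measure) = density (distr lborel borel (\<lambda>x. l *\<^sub>R x)) (\<lambda>_. ennreal (l ^ CARD('n)))"
  using lborel_affine[of l "0 :: real ^ 'n"] assms by (simp add: ennreal_power[symmetric])

lemma integral_dilation:
  fixes f :: "real ^ 'n \<Rightarrow> real"
  assumes l: "0 < l" and [measurable]: "f \<in> borel_measurable borel"
  shows "(\<integral>x. f (l *\<^sub>R x) \<partial>lborel) = (\<integral>x. f x \<partial>lborel) / l ^ CARD('n)"
proof -
  have "(\<integral>x. f x \<partial>lborel) = l ^ CARD('n) * (\<integral>x. f (l *\<^sub>R x) \<partial>lborel)"
    using l by (subst lborel_eq_density_dilation[OF l]) (simp add: integral_density integral_distr)
  then show ?thesis using l by simp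
qed

lemma integrable_dilation:
  fixes f :: "real ^ 'n \<Rightarrow> real"
  assumes l: "0 < l" and f: "integrable lborel f"
  shows "integrable lborel (\<lambda>x. f (l *\<^sub>R x))"
proof -
  have [measurable]: "f \<in> borel_measurable borel" using f by auto
  show ?thesis
    using f l by (subst (asm) lborel_eq_density_dilation[OF l])
      (simp add: integrable_density integrable_distr_eq)
qed

lemma in_L2_dilation:
  fixes f :: "real ^ 'n \<Rightarrow> real"
  assumes "0 < l" "in_Lp 2 f"
  shows "in_Lp 2 (\<lambda>x. f (l *\<^sub>R x))"
proof -
  have [measurable]: "f \<in> borel_measurable borel" using assms by (simp add: in_L2_iff)
  show ?thesis
    using assms integrable_dilation[of l "\<lambda>x. (norm (f x))\<^sup>2"] by (simp add: in_L2_iff)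
qed

lemma partial_dilation:
  assumes "\<And>x. f differentiable (at x)"
  shows "partial i (\<lambda>x. f (l *\<^sub>R x)) = (\<lambda>x. l * partial i f (l *\<^sub>R x))"
proof
  fix x
  have "(f has_derivative frechet_derivative f (at (l *\<^sub>R x))) (at (l *\<^sub>R x))"
    using assms frechet_derivative_works by blast
  then have "((\<lambda>x. f (l *\<^sub>R x)) has_derivative (\<lambda>h. frechet_derivative f (at (l *\<^sub>R x)) (l *\<^sub>R h))) (at x)"
    by (rule has_derivative_compose[rotated]) (auto intro!: derivative_eq_intros)
  from partial_eq[OF this, of i] show "partial i (\<lambda>x. f (l *\<^sub>R x)) x = l * partial i f (l *\<^sub>R x)"
    using linear_frechet_derivative[OF assms] by (simp add: partial_def linear_scale)
qed

text \<open>Every partial derivative brings out a factor \<open>l\<close>; the free factor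
  \<open>c\<close> lets the induction absorb it.\<close>

lemma C_k_dilation: "C_k k f \<Longrightarrow> C_k k (\<lambda>x. c * f (l *\<^sub>R x))"
proof (induction k arbitrary: f c)
  case 0
  then have "continuous_on UNIV f" by simp
  then show ?case by (auto intro!: continuous_intros continuous_on_compose2[of UNIV f])
next
  case (Suc k)
  then have d: "f differentiable (at x)" for x by simp
  have d': "(\<lambda>x. f (l *\<^sub>R x)) differentiable (at x)" for x
    by (rule differentiable_compose[OF d]) (auto simp: differentiable_def intro!: derivative_eq_intros)
  have "partial i (\<lambda>x. c * f (l *\<^sub>R x)) = (\<lambda>x. c * l * partial i f (l *\<^sub>R x))" for i
  proof
    fix x
    have "((\<lambda>x. c * f (l *\<^sub>R x)) has_derivative (\<lambda>h. c * frechet_derivative (\<lambda>x. f (l *\<^sub>R x)) (at x) h)) (at x)"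
      using d' by (intro has_derivative_mult_right) (auto simp: frechet_derivative_works)
    from partial_eq[OF this, of i] show "partial i (\<lambda>x. c * f (l *\<^sub>R x)) x = c * l * partial i f (l *\<^sub>R x)"
      using fun_cong[OF partial_dilation[OF d, of i l], of x] by (simp add: partial_def)
  qed
  moreover have "C_k k (\<lambda>x. c * l * partial i f (l *\<^sub>R x))" for i
    using Suc by simp
  ultimately show ?case using d' by simp
qed

lemma test_function_dilation:
  assumes "test_function \<phi>" "l \<noteq> 0"
  shows "test_function (\<lambda>x. \<phi> (l *\<^sub>R x))"
proof -
  have "{x. \<phi> (l *\<^sub>R x) \<noteq> 0} = (\<lambda>x. inverse l *\<^sub>R x) ` {x. \<phi> x \<noteq> 0}"
    using assms(2) by (auto intro!: image_eqI[of _ _ "l *\<^sub>R _"])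
  then have "compact (closure {x. \<phi> (l *\<^sub>R x) \<noteq> 0})"
    using assms by (simp add: test_function_def bounded_scaling compact_closure)
  then show ?thesis
    using assms C_k_dilation[of _ \<phi> 1 l] by (simp add: test_function_def)
qed

text \<open>A change of variables moves the dilation to the test function, which stays a test
  function; the chain rule yields the factor \<open>l\<close>.\<close>

lemma has_weak_partial_dilation:
  assumes l: "0 < l" and fg: "has_weak_partial i f g"
  shows "has_weak_partial i (\<lambda>x. m * f (l *\<^sub>R x)) (\<lambda>x. m * l * g (l *\<^sub>R x))"
proof -
  have L2: "in_Lp 2 f" "in_Lp 2 g" using fg by (auto simp: has_weak_partial_def)
  have "(\<integral>x. m * f (l *\<^sub>R x) * partial i \<phi> x \<partial>lborel) = - (\<integral>x. m * l * g (l *\<^sub>R x) * \<phi> x \<partial>lborel)"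
    if t: "test_function \<phi>" for \<phi>
  proof -
    \<comment> \<open>\<open>\<psi>\<close> undoes the dilation, so that both factors of each
      integrand depend on \<open>l *\<^sub>R x\<close> only.\<close>
    define \<psi> where "\<psi> x = \<phi> (inverse l *\<^sub>R x)" for x
    have \<psi>: "test_function \<psi>"
      unfolding \<psi>_def using l by (intro test_function_dilation[OF t]) auto
    have \<phi>: "\<phi> = (\<lambda>x. \<psi> (l *\<^sub>R x))" using l by (simp add: \<psi>_def)
    have "\<psi> differentiable (at x)" for x
      using \<psi> unfolding test_function_def by (meson C_k.simps(2))
    then have p: "partial i \<phi> x = l * partial i \<psi> (l *\<^sub>R x)" for x
      by (simp add: \<phi> partial_dilation)
    have [measurable]: "f \<in> borel_measurable borel" "g \<in> borel_measurable borel"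
      "\<psi> \<in> borel_measurable borel" "partial i \<psi> \<in> borel_measurable borel"
      using L2 test_function_in_L2[OF \<psi>] test_function_partial_in_L2[OF \<psi>, of i]
      by (auto simp: in_L2_iff)
    have "(\<integral>x. m * f (l *\<^sub>R x) * partial i \<phi> x \<partial>lborel) = (\<integral>x. m * l * (f (l *\<^sub>R x) * partial i \<psi> (l *\<^sub>R x)) \<partial>lborel)"
      by (simp add: p mult_ac)
    also have "\<dots> = m * l * ((\<integral>x. f x * partial i \<psi> x \<partial>lborel) / l ^ CARD('a))"
      using integral_dilation[OF l, of "\<lambda>x. f x * partial i \<psi> x"] by simp
    also have "\<dots> = - (m * l * ((\<integral>x. g x * \<psi> x \<partial>lborel) / l ^ CARD('a)))"
      using fg \<psi> by (simp add: has_weak_partial_def)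
    also have "\<dots> = - (\<integral>x. m * l * (g (l *\<^sub>R x) * \<psi> (l *\<^sub>R x)) \<partial>lborel)"
      using integral_dilation[OF l, of "\<lambda>x. g x * \<psi> x"] by simp
    finally show ?thesis by (simp add: \<phi> mult.assoc)
  qed
  then show ?thesis
    using L2 l by (simp add: has_weak_partial_def in_L2_cmult in_L2_dilation)
qed

lemma H2_dilation:
  assumes u: "u \<in> H2" and l: "0 < l"
  shows "(\<lambda>x. m * u (l *\<^sub>R x)) \<in> H2"
    and "AE x in lborel. grad (\<lambda>x. m * u (l *\<^sub>R x)) x = (m * l) *\<^sub>R grad u (l *\<^sub>R x)"
    and "AE x in lborel. laplacian (\<lambda>x. m * u (l *\<^sub>R x)) x = m * l\<^sup>2 * laplacian u (l *\<^sub>R x)"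
proof -
  let ?g = "\<lambda>i x. m * l * wpartial i u (l *\<^sub>R x)"
  let ?h = "\<lambda>i j x. m * l * l * wpartial j (wpartial i u) (l *\<^sub>R x)"
  have g: "has_weak_partial i (\<lambda>x. m * u (l *\<^sub>R x)) (?g i)" for i
    by (intro has_weak_partial_dilation H2_wpartial u l)
  have h: "has_weak_partial j (?g i) (?h i j)" for i j
    by (intro has_weak_partial_dilation H2_wpartial u l)
  show "(\<lambda>x. m * u (l *\<^sub>R x)) \<in> H2" by (rule H2_I(1)[OF g h])
  show "AE x in lborel. grad (\<lambda>x. m * u (l *\<^sub>R x)) x = (m * l) *\<^sub>R grad u (l *\<^sub>R x)"
    using H2_I(2)[OF g h] by eventually_elim (simp add: grad_def vec_eq_iff)
  show "AE x in lborel. laplacian (\<lambda>x. m * u (l *\<^sub>R x)) x = m * l\<^sup>2 * laplacian u (l *\<^sub>R x)"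
    using H2_I(3)[OF g h] by eventually_elim (simp add: laplacian_def sum_distrib_left power2_eq_square mult_ac)
qed

subsection \<open>Mass, kinetic energy and potential energy\<close>

text \<open>The function \<open>x powr (q + 1) - (q + 1) * x\<close> decreases up to 1 and increases
  afterwards, and its value at 1 is \<open>- q\<close>. The strictness later forces the mass of an
  action ground state to be \<open>c\<close>.\<close>

lemma strict_Bernoulli_powr:
  fixes s q :: real
  assumes "0 < s" "s \<noteq> 1" "0 < q"
  shows "(q + 1) * s < q + s powr (q + 1)"
proof -
  define f where "f x = x powr (q + 1) - (q + 1) * x" for x
  have der: "(f has_real_derivative (q + 1) * (x powr q - 1)) (at x)" if "0 < x" for x
    unfolding f_def using that by (auto intro!: derivative_eq_intros simp: algebra_simps)
  have cont: "isCont f x" if "0 < x" for x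
    using der[OF that] by (rule DERIV_isCont)
  have "f 1 < f s"
  proof (cases "s < 1")
    case True
    have "(q + 1) * (x powr q - 1) < 0" if "s < x" "x < 1" for x
      using that assms powr_less_mono2[of q x 1] by (auto simp: mult_pos_neg)
    moreover have "continuous_on {s..1} f"
      using cont assms by (intro continuous_at_imp_continuous_on) auto
    ultimately show ?thesis
      using True der order.strict_trans[OF \<open>0 < s\<close>] by (intro DERIV_neg_imp_decreasing_open[of s 1 f]) blast+
  next
    case False
    have "0 < (q + 1) * (x powr q - 1)" if "1 < x" "x < s" for x
      using that assms powr_less_mono2[of q 1 x] by auto
    moreover have "continuous_on {1..s} f"
      using cont by (intro continuous_at_imp_continuous_on) auto
    ultimately show ?thesis
      using False assms der order.strict_trans[OF zero_less_one]
      by (intro DERIV_pos_imp_increasing_open[of 1 s f]) (force, blast+)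
  qed
  then show ?thesis by (simp add: f_def)
qed

section \<open>Convexity of the p-th power\<close>

lemma abs_powr_diff_1: "\<bar>a :: real\<bar> powr (p - 2) * \<bar>a\<bar> = \<bar>a\<bar> powr (p - 1)"
  using powr_add[of "\<bar>a\<bar>" "p - 2" 1] by (cases "a = 0") auto

lemma abs_powr_diff_2: "\<bar>a :: real\<bar> powr (p - 2) * a * a = \<bar>a\<bar> powr p"
proof (cases "a = 0")
  case False
  have "\<bar>a\<bar> powr (p - 2) * a * a = \<bar>a\<bar> powr (p - 2) * (\<bar>a\<bar> * \<bar>a\<bar>)" by simp
  then show ?thesis using False powr_add[of "\<bar>a\<bar>" "p - 2" 2] by (simp add: power2_eq_square)
qed simp

lemma Young_powr:
  fixes x y p :: real
  assumes "1 < p" "0 \<le> x" "0 \<le> y"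
  shows "p * (x powr (p - 1) * y) \<le> (p - 1) * x powr p + y powr p"
proof -
  have "x powr (p - 1) * y \<le> (x powr (p - 1)) powr (p / (p - 1)) / (p / (p - 1)) + y powr p / p"
    using assms by (intro Youngs_inequality) (auto simp: field_simps)
  also have "\<dots> = x powr p * (p - 1) / p + y powr p / p"
    using assms by (simp add: powr_powr)
  finally show ?thesis using assms by (simp add: field_simps)
qed

text \<open>The tangent line at \<open>a\<close> lies below the convex function. Young's inequality
  applied to the mixed term proves this without any derivative.\<close>

lemma abs_powr_above_tangent:
  fixes a x p :: real
  assumes "1 < p"
  shows "\<bar>a\<bar> powr p + p * (\<bar>a\<bar> powr (p - 2) * a * (x - a)) \<le> \<bar>x\<bar> powr p"
proof -
  have "\<bar>a\<bar> powr (p - 2) * a * x \<le> \<bar>a\<bar> powr (p - 2) * \<bar>a\<bar> * \<bar>x\<bar>"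
    using abs_ge_self[of "\<bar>a\<bar> powr (p - 2) * a * x"] by (simp add: abs_mult)
  then have "p * (\<bar>a\<bar> powr (p - 2) * a * x) \<le> p * (\<bar>a\<bar> powr (p - 1) * \<bar>x\<bar>)"
    unfolding abs_powr_diff_1 using assms by (intro mult_left_mono) auto
  also have "\<dots> \<le> (p - 1) * \<bar>a\<bar> powr p + \<bar>x\<bar> powr p"
    using assms by (intro Young_powr) auto
  finally show ?thesis using abs_powr_diff_2[of a p] by (simp add: algebra_simps)
qed

lemma INF_ereal_attained:
  assumes "w \<in> S" "\<And>u. u \<in> S \<Longrightarrow> f w \<le> f u"
  shows "(INF u\<in>S. ereal (f u)) = ereal (f w)"
  using assms by (intro antisym INF_lower INF_greatest) auto

section \<open>Norms and functionals as integrals\<close>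

lemma Lp_norm_2_square: "(Lp_norm 2 f)\<^sup>2 = (\<integral>x. (norm (f x))\<^sup>2 \<partial>lborel)"
  by (simp add: Lp_norm_def powr_half_sqrt)

lemma Lp_norm_2_powr: "Lp_norm 2 f powr s = (\<integral>x. (norm (f x))\<^sup>2 \<partial>lborel) powr (s / 2)"
  by (simp add: Lp_norm_def powr_powr)

lemma Lp_norm_powr:
  "p \<noteq> 0 \<Longrightarrow> Lp_norm p (f :: real ^ 'n \<Rightarrow> real) powr p = (\<integral>x. \<bar>f x\<bar> powr p \<partial>lborel)"
  by (simp add: Lp_norm_def powr_powr)

definition mass :: "(real ^ 'n \<Rightarrow> real) \<Rightarrow> real" where
  "mass u = (\<integral>x. (u x)\<^sup>2 \<partial>lborel)"

text \<open>The quadratic form without the factor 1/2 of the energy, as it enters the Nehari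
  constraint.\<close>

definition kinetic :: "real \<Rightarrow> (real ^ 'n \<Rightarrow> real) \<Rightarrow> real" where
  "kinetic \<epsilon> u = \<epsilon> * (\<integral>x. (laplacian u x)\<^sup>2 \<partial>lborel) + (\<integral>x. (norm (grad u x))\<^sup>2 \<partial>lborel)"

definition potential :: "real \<Rightarrow> (real ^ 'n \<Rightarrow> real) \<Rightarrow> real" where
  "potential p u = (\<integral>x. \<bar>u x\<bar> powr p \<partial>lborel)"

lemma energy_eq: "energy \<epsilon> p u = kinetic \<epsilon> u / 2 - potential p u / p"
  by (simp add: energy_def kinetic_def potential_def add_divide_distrib)

lemma action_eq: "action \<epsilon> p \<omega> u = energy \<epsilon> p u + \<omega> / 2 * mass u"
  by (simp add: action_def Lp_norm_2_square mass_def)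

lemma mass_nonneg: "0 \<le> mass u"
  by (simp add: mass_def)

lemma kinetic_nonneg: "0 \<le> \<epsilon> \<Longrightarrow> 0 \<le> kinetic \<epsilon> u"
  by (simp add: kinetic_def)

lemma mass_sphere_iff: "u \<in> mass_sphere c \<longleftrightarrow> u \<in> H2 \<and> mass u = c"
  by (simp add: mass_sphere_def mass_def)

lemma nonzero_iff_mass_pos:
  assumes "in_Lp 2 u"
  shows "nonzero u \<longleftrightarrow> 0 < mass u"
proof -
  have "(\<integral>x. (u x)\<^sup>2 \<partial>lborel) = 0 \<longleftrightarrow> (AE x in lborel. (u x)\<^sup>2 = 0)"
    using assms by (intro integral_nonneg_eq_0_iff_AE) (auto simp: in_L2_iff)
  then have "nonzero u \<longleftrightarrow> mass u \<noteq> 0" by (simp add: nonzero_def mass_def)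
  then show ?thesis using mass_nonneg[of u] by linarith
qed

lemma nehari_iff:
  assumes "p \<noteq> 0"
  shows "u \<in> nehari \<epsilon> p \<omega> \<longleftrightarrow> u \<in> H2 \<and> 0 < mass u \<and> potential p u = kinetic \<epsilon> u + \<omega> * mass u"
  unfolding nehari_def using nonzero_iff_mass_pos[OF H2_in_L2, of u] assms
  by (auto simp: Lp_norm_2_square Lp_norm_powr mass_def kinetic_def potential_def algebra_simps)

text \<open>Inner products cover the scalar Laplacian and the vector-valued gradient at once;
  \<open>h\<close> is prescribed only almost everywhere, since weak derivatives of a linear
  combination are known only up to null sets.\<close>

lemma L2_integral_square_lincomb:
  fixes f g h :: "real ^ 'n \<Rightarrow> 'b::euclidean_space"
  assumes f: "in_Lp 2 f" and g: "in_Lp 2 g" and fg: "integrable lborel (\<lambda>x. f x \<bullet> g x)"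
    and h: "AE x in lborel. h x = f x + t *\<^sub>R g x" "h \<in> borel_measurable borel"
  shows "(\<integral>x. (norm (h x))\<^sup>2 \<partial>lborel)
    = (\<integral>x. (norm (f x))\<^sup>2 \<partial>lborel) + 2 * t * (\<integral>x. f x \<bullet> g x \<partial>lborel) + t\<^sup>2 * (\<integral>x. (norm (g x))\<^sup>2 \<partial>lborel)"
proof -
  have [measurable]: "f \<in> borel_measurable borel" "g \<in> borel_measurable borel"
    using f g by (auto simp: in_L2_iff)
  have "(\<integral>x. (norm (h x))\<^sup>2 \<partial>lborel) = (\<integral>x. (norm (f x + t *\<^sub>R g x))\<^sup>2 \<partial>lborel)"
    using h by (intro integral_cong_AE) auto
  also have "(\<lambda>x. (norm (f x + t *\<^sub>R g x))\<^sup>2) = (\<lambda>x. (norm (f x))\<^sup>2 + 2 * t * (f x \<bullet> g x) + t\<^sup>2 * (norm (g x))\<^sup>2)"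
    by (simp only: power2_norm_eq_inner) (simp add: inner_add inner_commute algebra_simps power2_eq_square)
  finally show ?thesis using f g fg by (simp add: in_L2_iff)
qed

lemma L2_inner_integrable:
  fixes f g :: "real ^ 'n \<Rightarrow> real ^ 'm"
  assumes "in_Lp 2 f" "in_Lp 2 g"
  shows "integrable lborel (\<lambda>x. f x \<bullet> g x)"
proof (rule Bochner_Integration.integrable_bound)
  have [measurable]: "f \<in> borel_measurable borel" "g \<in> borel_measurable borel"
    using assms by (auto simp: in_L2_iff)
  show "(\<lambda>x. f x \<bullet> g x) \<in> borel_measurable lborel" by measurable
  show "integrable lborel (\<lambda>x. norm (f x) * norm (g x))"
    using assms by (intro L2_mult_integrable) (auto simp: in_L2_iff)
  show "AE x in lborel. norm (f x \<bullet> g x) \<le> norm (norm (f x) * norm (g x))"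
    by (auto simp: Cauchy_Schwarz_ineq2)
qed

lemma mass_lincomb:
  assumes u: "in_Lp 2 u" and \<phi>: "in_Lp 2 \<phi>"
  shows "mass (\<lambda>x. u x + t * \<phi> x) = mass u + 2 * t * (\<integral>x. u x * \<phi> x \<partial>lborel) + t\<^sup>2 * mass \<phi>"
  using L2_integral_square_lincomb[OF u \<phi>, of "\<lambda>x. u x + t * \<phi> x" t] L2_mult_integrable[OF u \<phi>]
    in_L2_measurable[OF u] in_L2_measurable[OF \<phi>]
  by (simp add: mass_def)

lemma kinetic_lincomb:
  assumes u: "u \<in> H2" and \<phi>: "\<phi> \<in> H2"
  shows "kinetic \<epsilon> (\<lambda>x. u x + t * \<phi> x) = kinetic \<epsilon> u
    + 2 * t * (\<epsilon> * (\<integral>x. laplacian u x * laplacian \<phi> x \<partial>lborel) + (\<integral>x. grad u x \<bullet> grad \<phi> x \<partial>lborel))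
    + t\<^sup>2 * kinetic \<epsilon> \<phi>"
proof -
  let ?w = "\<lambda>x. u x + t * \<phi> x"
  note w = H2_lincomb[OF u \<phi>, of t]
  note lu = H2_laplacian_in_L2[OF u] and lf = H2_laplacian_in_L2[OF \<phi>]
  note gu = H2_grad_in_L2[OF u] and gf = H2_grad_in_L2[OF \<phi>]
  have "(\<integral>x. (norm (grad ?w x))\<^sup>2 \<partial>lborel) = (\<integral>x. (norm (grad u x))\<^sup>2 \<partial>lborel)
      + 2 * t * (\<integral>x. grad u x \<bullet> grad \<phi> x \<partial>lborel) + t\<^sup>2 * (\<integral>x. (norm (grad \<phi> x))\<^sup>2 \<partial>lborel)"
    by (rule L2_integral_square_lincomb[OF gu gf L2_inner_integrable[OF gu gf] w(2)
        in_L2_measurable[OF H2_grad_in_L2[OF w(1)]]])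
  moreover have "(\<integral>x. (norm (laplacian ?w x))\<^sup>2 \<partial>lborel) = (\<integral>x. (norm (laplacian u x))\<^sup>2 \<partial>lborel)
      + 2 * t * (\<integral>x. laplacian u x \<bullet> laplacian \<phi> x \<partial>lborel) + t\<^sup>2 * (\<integral>x. (norm (laplacian \<phi> x))\<^sup>2 \<partial>lborel)"
    using w(3) L2_mult_integrable[OF lu lf]
    by (intro L2_integral_square_lincomb[OF lu lf _ _ in_L2_measurable[OF H2_laplacian_in_L2[OF w(1)]]]) auto
  ultimately show ?thesis by (simp add: kinetic_def algebra_simps)
qed

lemma potential_integrable_duality:
  fixes u \<phi> :: "real ^ 'n \<Rightarrow> real"
  assumes "1 < p" and u: "in_Lp p u" and \<phi>: "in_Lp p \<phi>"
  shows "integrable lborel (\<lambda>x. \<bar>u x\<bar> powr (p - 2) * u x * \<phi> x)"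
proof (rule Bochner_Integration.integrable_bound)
  have [measurable]: "u \<in> borel_measurable borel" "\<phi> \<in> borel_measurable borel"
    using u \<phi> by (auto simp: in_Lp_def)
  show "(\<lambda>x. \<bar>u x\<bar> powr (p - 2) * u x * \<phi> x) \<in> borel_measurable lborel" by measurable
  show "integrable lborel (\<lambda>x. (p - 1) * \<bar>u x\<bar> powr p + \<bar>\<phi> x\<bar> powr p)"
    using u \<phi> by (auto simp: in_Lp_def)
  have "\<bar>a\<bar> powr (p - 2) * \<bar>a\<bar> * \<bar>b\<bar> \<le> (p - 1) * \<bar>a\<bar> powr p + \<bar>b\<bar> powr p" for a b :: real
  proof -
    \<comment> \<open>As \<open>1 < p\<close>, the factor \<open>p\<close> in Young's inequality may
      be dropped.\<close>
    have "1 * (\<bar>a\<bar> powr (p - 1) * \<bar>b\<bar>) \<le> p * (\<bar>a\<bar> powr (p - 1) * \<bar>b\<bar>)"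
      using \<open>1 < p\<close> by (intro mult_right_mono) auto
    then show ?thesis using Young_powr[of p "\<bar>a\<bar>" "\<bar>b\<bar>"] \<open>1 < p\<close> by (simp add: abs_powr_diff_1)
  qed
  then show "AE x in lborel. norm (\<bar>u x\<bar> powr (p - 2) * u x * \<phi> x) \<le> norm ((p - 1) * \<bar>u x\<bar> powr p + \<bar>\<phi> x\<bar> powr p)"
    using \<open>1 < p\<close> by (simp add: abs_mult)
qed

text \<open>Integrates the tangent inequality at \<open>u x\<close>. The bound is affine in
  \<open>t\<close> and exact at \<open>t = 0\<close>, which suffices for a first-order
  condition.\<close>

lemma potential_above_tangent:
  fixes u \<phi> :: "real ^ 'n \<Rightarrow> real"
  assumes "1 < p" and u: "in_Lp p u" and \<phi>: "in_Lp p \<phi>" and w: "in_Lp p (\<lambda>x. u x + t * \<phi> x)"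
  shows "potential p u + t * p * (\<integral>x. \<bar>u x\<bar> powr (p - 2) * u x * \<phi> x \<partial>lborel)
    \<le> potential p (\<lambda>x. u x + t * \<phi> x)"
proof -
  note int = potential_integrable_duality[OF assms(1-3)]
  have "potential p u + t * p * (\<integral>x. \<bar>u x\<bar> powr (p - 2) * u x * \<phi> x \<partial>lborel)
      = (\<integral>x. \<bar>u x\<bar> powr p + t * p * (\<bar>u x\<bar> powr (p - 2) * u x * \<phi> x) \<partial>lborel)"
    using u int by (simp add: potential_def in_Lp_def)
  also have "\<dots> \<le> potential p (\<lambda>x. u x + t * \<phi> x)"
    unfolding potential_def
  proof (rule integral_mono)
    show "integrable lborel (\<lambda>x. \<bar>u x\<bar> powr p + t * p * (\<bar>u x\<bar> powr (p - 2) * u x * \<phi> x))"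
      using u int by (simp add: in_Lp_def)
    show "integrable lborel (\<lambda>x. \<bar>u x + t * \<phi> x\<bar> powr p)" using w by (simp add: in_Lp_def)
    show "\<bar>u x\<bar> powr p + t * p * (\<bar>u x\<bar> powr (p - 2) * u x * \<phi> x) \<le> \<bar>u x + t * \<phi> x\<bar> powr p" for x
      using abs_powr_above_tangent[OF \<open>1 < p\<close>, of "u x" "u x + t * \<phi> x"] by (simp add: mult_ac)
  qed
  finally show ?thesis .
qed

lemma lagrange_multiplier_test_self:
  assumes "lagrange_multiplier \<epsilon> p \<omega> u"
  shows "potential p u = kinetic \<epsilon> u + \<omega> * mass u"
proof -
  have "\<epsilon> * (\<integral>x. laplacian u x * laplacian u x \<partial>lborel) + (\<integral>x. grad u x \<bullet> grad u x \<partial>lborel)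
      + \<omega> * (\<integral>x. u x * u x \<partial>lborel) = (\<integral>x. \<bar>u x\<bar> powr (p - 2) * u x * u x \<partial>lborel)"
    using assms by (auto simp: lagrange_multiplier_def)
  then show ?thesis
    by (simp add: abs_powr_diff_2 potential_def kinetic_def mass_def power2_norm_eq_inner)
      (simp add: power2_eq_square)
qed

section \<open>Scaling laws of the functionals\<close>

lemma mass_dilation:
  fixes u :: "real ^ 'n \<Rightarrow> real"
  assumes "in_Lp 2 u" "0 < l"
  shows "mass (\<lambda>x. m * u (l *\<^sub>R x)) = m\<^sup>2 * mass u / l ^ CARD('n)"
proof -
  have [measurable]: "u \<in> borel_measurable borel" using assms by (simp add: in_L2_iff)
  show ?thesis
    using integral_dilation[OF assms(2), of "\<lambda>x. (u x)\<^sup>2"] by (simp add: mass_def power_mult_distrib)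
qed

lemma potential_dilation:
  fixes u :: "real ^ 'n \<Rightarrow> real"
  assumes "in_Lp 2 u" "0 < l"
  shows "potential p (\<lambda>x. m * u (l *\<^sub>R x)) = \<bar>m\<bar> powr p * potential p u / l ^ CARD('n)"
proof -
  have [measurable]: "u \<in> borel_measurable borel" using assms by (simp add: in_L2_iff)
  show ?thesis
    using integral_dilation[OF assms(2), of "\<lambda>x. \<bar>u x\<bar> powr p"]
    by (simp add: potential_def abs_mult powr_mult)
qed

text \<open>The squared Laplacian gains the factor \<open>l ^ 4\<close> and the squared gradient
  \<open>l ^ 2\<close>; the surplus \<open>l ^ 2\<close> is absorbed into the weight
  \<open>\<epsilon>\<close>.\<close>

lemma kinetic_dilation:
  fixes u :: "real ^ 'n \<Rightarrow> real"
  assumes u: "u \<in> H2" and l: "0 < l"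
  shows "kinetic \<epsilon> (\<lambda>x. m * u (l *\<^sub>R x)) = m\<^sup>2 * l\<^sup>2 * kinetic (\<epsilon> * l\<^sup>2) u / l ^ CARD('n)"
proof -
  let ?w = "\<lambda>x. m * u (l *\<^sub>R x)"
  note w = H2_dilation[OF u l, of m]
  note [measurable] = in_L2_measurable[OF H2_grad_in_L2[OF u]] in_L2_measurable[OF H2_laplacian_in_L2[OF u]]
    in_L2_measurable[OF H2_grad_in_L2[OF w(1)]] in_L2_measurable[OF H2_laplacian_in_L2[OF w(1)]]
  have "(\<integral>x. (norm (grad ?w x))\<^sup>2 \<partial>lborel) = (\<integral>x. (m * l)\<^sup>2 * (norm (grad u (l *\<^sub>R x)))\<^sup>2 \<partial>lborel)"
    using w(2) by (intro integral_cong_AE) (auto simp: power_mult_distrib)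
  moreover have "(\<integral>x. (laplacian ?w x)\<^sup>2 \<partial>lborel) = (\<integral>x. (m * l\<^sup>2)\<^sup>2 * (laplacian u (l *\<^sub>R x))\<^sup>2 \<partial>lborel)"
    using w(3) by (intro integral_cong_AE) (auto simp: power_mult_distrib)
  ultimately show ?thesis
    using integral_dilation[OF l, of "\<lambda>x. (norm (grad u x))\<^sup>2"] integral_dilation[OF l, of "\<lambda>x. (laplacian u x)\<^sup>2"] l
    by (simp add: kinetic_def field_simps power2_eq_square)
qed

subsection \<open>The variational problems at the critical mass\<close>

locale GN_setting =
  fixes p \<epsilon> C :: real and v :: "real ^ 'n \<Rightarrow> real"
  assumes p_lower: "4 < real CARD('n) * (p - 2)" and p_upper: "real CARD('n) * (p - 2) < 8"
    and \<epsilon>_pos: "0 < \<epsilon>" and C_pos: "0 < C"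
    and GN: "GN_inequality TYPE('n) p C"
    and v: "GN_optimizer p C v"
    and grad_v: "Lp_norm 2 (grad v) = 1" and laplacian_v: "Lp_norm 2 (laplacian v) = 1"
begin

text \<open>\<open>\<alpha>\<close>, \<open>\<beta>\<close> and \<open>q\<close> are the exponents
  of the interpolation inequality in terms of squared norms. The first two sum to 1 and serve as
  weights in the arithmetic-geometric mean inequality.\<close>

definition "\<alpha> = (real CARD('n) * (p - 2) - 4) / 4"
definition "\<beta> = (8 - real CARD('n) * (p - 2)) / 4"
definition "q = (p - 2) / 2"
definition "c = critical_mass CARD('n) p C \<epsilon>"
text \<open>The constant that results from bounding the product of powers in the interpolation
  inequality by the kinetic energy.\<close>

definition "D = C * \<alpha> powr \<alpha> * \<beta> powr \<beta> / \<epsilon> powr \<alpha>"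
text \<open>The frequency of the theorem, expressed through these exponents.\<close>

definition "freq = q * \<alpha> / (\<beta>\<^sup>2 * mass v * \<epsilon>)"

lemma exponents: "0 < \<alpha>" "0 < \<beta>" "\<alpha> + \<beta> = 1" "0 < q" "p = 2 * (q + 1)"
proof -
  show "0 < \<alpha>" "0 < \<beta>" "\<alpha> + \<beta> = 1"
    using p_lower p_upper by (simp_all add: \<alpha>_def \<beta>_def field_simps)
  have "0 < real CARD('n) * (p - 2)" using p_lower by linarith
  then show "0 < q" by (simp add: q_def zero_less_mult_iff)
  show "p = 2 * (q + 1)" by (simp add: q_def field_simps)
qed

lemma half_p: "p / 2 = q + 1"
  by (simp add: q_def field_simps)

lemma p_gt_2: "2 < p" using exponents by simp

lemma c_eq:
  "c = C powr (- 1 / q) * (p / (2 * \<alpha>)) powr (\<alpha> / q) * (p / (2 * \<beta>)) powr (\<beta> / q) * \<epsilon> powr (\<alpha> / q)"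
proof -
  have N: "real CARD('n) * (p - 2) - 4 = 4 * \<alpha>" "8 - real CARD('n) * (p - 2) = 4 * \<beta>" "p - 2 = 2 * q"
    by (simp_all add: \<alpha>_def \<beta>_def q_def)
  have e: "- 2 / (2 * q) = - 1 / q" "2 * p / (4 * \<alpha>) = p / (2 * \<alpha>)" "2 * p / (4 * \<beta>) = p / (2 * \<beta>)"
    "4 * \<alpha> / (2 * (2 * q)) = \<alpha> / q" "4 * \<beta> / (2 * (2 * q)) = \<beta> / q"
    by simp_all
  show ?thesis
    unfolding c_def critical_mass_def N(1,2) unfolding N(3) by (simp only: e)
qed

lemma c_pos: "0 < c"
  unfolding c_eq using exponents C_pos \<epsilon>_pos by simp

text \<open>The outer exponents \<open>1 / q\<close> in \<open>c\<close> cancel, and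
  \<open>\<alpha> + \<beta> = 1\<close> merges the two powers of \<open>p / 2\<close>.\<close>

lemma C_c_powr: "C * c powr q = p / 2 * \<epsilon> powr \<alpha> / (\<alpha> powr \<alpha> * \<beta> powr \<beta>)"
proof -
  have "c powr q = ((p / (2 * \<alpha>)) powr \<alpha> * (p / (2 * \<beta>)) powr \<beta>) * \<epsilon> powr \<alpha> / C"
    unfolding c_eq using exponents C_pos by (simp add: powr_mult powr_divide powr_powr powr_minus_divide)
  also have "(p / (2 * \<alpha>)) powr \<alpha> * (p / (2 * \<beta>)) powr \<beta>
      = (p / 2) powr \<alpha> * (p / 2) powr \<beta> / (\<alpha> powr \<alpha> * \<beta> powr \<beta>)"
    using exponents powr_divide[of "p / 2" \<alpha> \<alpha>] powr_divide[of "p / 2" \<beta> \<beta>] by simp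
  also have "(p / 2) powr \<alpha> * (p / 2) powr \<beta> = p / 2"
    using exponents(3) p_gt_2 by (simp flip: powr_add)
  finally show ?thesis using C_pos by simp
qed

text \<open>This is what makes the mass critical: at mass \<open>c\<close> the bound in
  \<open>potential_le\<close> becomes \<open>p / 2\<close> times the kinetic energy, which says
  exactly that the energy is nonnegative.\<close>

lemma D_c_powr: "D * c powr q = p / 2"
  using C_c_powr exponents \<epsilon>_pos by (simp add: D_def field_simps)

lemma H2_in_Lp: "u \<in> H2 \<Longrightarrow> in_Lp p (u :: real ^ 'n \<Rightarrow> real)"
  using GN by (simp add: GN_inequality_def)

lemma GN_rhs_eq:
  fixes u :: "real ^ 'n \<Rightarrow> real"
  shows "GN_rhs p C u = C * (\<integral>x. (laplacian u x)\<^sup>2 \<partial>lborel) powr \<alpha>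
    * (\<integral>x. (norm (grad u x))\<^sup>2 \<partial>lborel) powr \<beta> * mass u powr q"
proof -
  have e: "(real CARD('n) * (p - 2) - 4) / 2 / 2 = \<alpha>" "(8 - real CARD('n) * (p - 2)) / 2 / 2 = \<beta>"
    "(p - 2) / 2 = q"
    by (simp_all add: \<alpha>_def \<beta>_def q_def)
  show ?thesis
    unfolding GN_rhs_def Lp_norm_2_powr e by (simp add: mass_def)
qed

lemma potential_le:
  fixes u :: "real ^ 'n \<Rightarrow> real"
  assumes "u \<in> H2"
  shows "potential p u \<le> D * kinetic \<epsilon> u * mass u powr q"
proof -
  let ?A = "\<integral>x. (laplacian u x)\<^sup>2 \<partial>lborel" and ?B = "\<integral>x. (norm (grad u x))\<^sup>2 \<partial>lborel"
  have AB: "0 \<le> ?A" "0 \<le> ?B" by simp_all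
  have "?A powr \<alpha> * ?B powr \<beta> \<le> \<alpha> powr \<alpha> * \<beta> powr \<beta> / \<epsilon> powr \<alpha> * kinetic \<epsilon> u"
  proof (cases "?A = 0 \<or> ?B = 0")
    \<comment> \<open>The exponents are positive, so a factor 0 makes the product 0.\<close>
    case True
    then show ?thesis using kinetic_nonneg[of \<epsilon> u] \<epsilon>_pos exponents by auto
  next
    case False
    then have "0 < ?A" "0 < ?B" using AB by linarith+
    \<comment> \<open>Dividing by the weights turns the weighted arithmetic mean into the kinetic
      energy.\<close>
    then have "(\<epsilon> * ?A / \<alpha>) powr \<alpha> * (?B / \<beta>) powr \<beta> \<le> \<alpha> * (\<epsilon> * ?A / \<alpha>) + \<beta> * (?B / \<beta>)"
      using exponents \<epsilon>_pos by (intro Youngs_inequality_0) auto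
    then have "\<epsilon> powr \<alpha> * (?A powr \<alpha> * ?B powr \<beta>) / (\<alpha> powr \<alpha> * \<beta> powr \<beta>) \<le> kinetic \<epsilon> u"
      using exponents \<epsilon>_pos AB by (simp add: powr_mult powr_divide kinetic_def mult_ac)
    then show ?thesis
      using exponents \<epsilon>_pos by (simp add: field_simps)
  qed
  then have "C * (?A powr \<alpha> * ?B powr \<beta>) * mass u powr q
      \<le> C * (\<alpha> powr \<alpha> * \<beta> powr \<beta> / \<epsilon> powr \<alpha> * kinetic \<epsilon> u) * mass u powr q"
    using C_pos by (intro mult_right_mono mult_left_mono) auto
  moreover have "potential p u \<le> GN_rhs p C u"
    using GN assms Lp_norm_powr[of p u] p_gt_2 by (auto simp: GN_inequality_def potential_def)
  ultimately show ?thesis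
    by (simp add: GN_rhs_eq D_def mult.assoc)
qed

lemma energy_nonneg:
  fixes u :: "real ^ 'n \<Rightarrow> real"
  assumes "u \<in> H2" "mass u = c"
  shows "0 \<le> energy \<epsilon> p u"
proof -
  have "potential p u \<le> (D * c powr q) * kinetic \<epsilon> u"
    using potential_le[OF assms(1)] assms(2) by (simp add: mult_ac)
  then show ?thesis
    unfolding D_c_powr energy_eq using p_gt_2 by (simp add: field_simps)
qed

text \<open>
  On the Nehari manifold the Gagliardo--Nirenberg bound reads
  \<open>X + \<omega> M \<le> (q + 1) (M / c) powr q * X\<close> for the kinetic energy \<open>X\<close> and the mass \<open>M\<close>.
  This bounds \<open>X + \<omega> M\<close> from below by a function of \<open>M\<close> alone, whose only minimum point
  is \<open>M = c\<close> by Bernoulli's inequality.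
\<close>

lemma action_lower_bound:
  fixes u :: "real ^ 'n \<Rightarrow> real"
  assumes \<omega>: "0 < \<omega>" and u: "u \<in> nehari \<epsilon> p \<omega>"
  shows "\<omega> * c / 2 \<le> action \<epsilon> p \<omega> u"
    and "action \<epsilon> p \<omega> u = \<omega> * c / 2 \<Longrightarrow> mass u = c"
proof -
  define X where "X = kinetic \<epsilon> u"
  define m where "m = mass u / c"
  \<comment> \<open>Since \<open>D * c powr q = p / 2 = q + 1\<close>, this is the factor
    \<open>D * mass u powr q\<close> in the bound on the potential.\<close>
  define y where "y = (q + 1) * m powr q"
  have H: "u \<in> H2" "0 < mass u" "potential p u = X + \<omega> * mass u"
    using u p_gt_2 by (simp_all add: nehari_iff X_def)
  have m: "0 < m" "mass u = c * m" using H c_pos by (simp_all add: m_def)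
  have X: "0 \<le> X" using kinetic_nonneg[of \<epsilon> u] \<epsilon>_pos by (simp add: X_def)
  have "D * mass u powr q = (D * c powr q) * m powr q"
    using m c_pos by (simp add: powr_mult)
  then have y: "D * mass u powr q = y"
    unfolding D_c_powr y_def half_p by simp
  have le: "X + \<omega> * c * m \<le> y * X"
    using potential_le[OF H(1)] H(3) y by (simp add: X_def m mult_ac)
  have pos: "0 < \<omega> * c * m" using \<omega> c_pos m by simp
  \<comment> \<open>The positive term in \<open>le\<close> excludes \<open>y \<le> 1\<close>, so
    \<open>y - 1\<close> can be cancelled at the end.\<close>
  have y1: "1 < y"
  proof (rule ccontr)
    assume "\<not> 1 < y"
    then have "y * X \<le> 1 * X" using X by (intro mult_right_mono) auto
    then show False using le pos by linarith
  qed
  have mp: "m powr (q + 1) = m * m powr q" using m by (simp add: powr_add)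
  have s: "m powr (q + 1) * (1 / m) powr (q + 1) = 1" "m powr (q + 1) * (1 / m) = m powr q"
    using m mp by (simp_all add: powr_divide)
  \<comment> \<open>Bernoulli's inequality is used at \<open>1 / m\<close>; multiplication by
    \<open>m powr (q + 1)\<close> turns it into a bound on \<open>y\<close>.\<close>
  have scale: "(q + 1) * (1 / m) < q + (1 / m) powr (q + 1) \<Longrightarrow> y < q * (m * m powr q) + 1"
  proof -
    assume "(q + 1) * (1 / m) < q + (1 / m) powr (q + 1)"
    then have "m powr (q + 1) * ((q + 1) * (1 / m)) < m powr (q + 1) * (q + (1 / m) powr (q + 1))"
      using m by (intro mult_strict_left_mono) auto
    then show ?thesis using s mp m by (simp add: y_def algebra_simps)
  qed
  have strict: "y < q * (m * m powr q) + 1" if "m \<noteq> 1"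
    using that m exponents by (intro scale strict_Bernoulli_powr) auto
  have weak: "y - 1 \<le> q * (m * m powr q)"
    using strict exponents by (cases "m = 1") (auto simp: y_def)
  \<comment> \<open>On the Nehari manifold the potential is \<open>X + \<omega> * mass u\<close>,
    which leaves the coefficient \<open>1 / 2 - 1 / p = q / (2 * (q + 1))\<close>.\<close>
  have act: "2 * action \<epsilon> p \<omega> u = q / (q + 1) * (X + \<omega> * c * m)"
    using H(3) p_gt_2 unfolding action_eq energy_eq X_def[symmetric] m(2) q_def
    by (simp add: field_simps)
  \<comment> \<open>Rewrites \<open>le\<close> in terms of the sum that the action is a multiple of,
    so that \<open>X\<close> no longer occurs alone.\<close>
  have key: "(X + \<omega> * c * m) * (y - 1) \<ge> \<omega> * c * m * y"
    using le by (simp add: algebra_simps)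
  have my: "q / (q + 1) * (m * y) = q * (m * m powr q)"
    using exponents by (simp add: y_def)
  have "q / (q + 1) * (\<omega> * c * m * y) \<le> q / (q + 1) * ((X + \<omega> * c * m) * (y - 1))"
    using key exponents by (intro mult_left_mono) auto
  then have main: "\<omega> * c * (q * (m * m powr q)) \<le> 2 * action \<epsilon> p \<omega> u * (y - 1)"
    unfolding act my[symmetric] by (simp add: mult_ac)
  have "\<omega> * c * (y - 1) \<le> \<omega> * c * (q * (m * m powr q))"
    using weak \<omega> c_pos by (intro mult_left_mono) auto
  then have "\<omega> * c * (y - 1) \<le> 2 * action \<epsilon> p \<omega> u * (y - 1)" using main by linarith
  then show "\<omega> * c / 2 \<le> action \<epsilon> p \<omega> u" using y1 by simp
  assume eq: "action \<epsilon> p \<omega> u = \<omega> * c / 2"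
  have "m = 1"
  proof (rule ccontr)
    assume "m \<noteq> 1"
    \<comment> \<open>For \<open>m\<close> other than 1 the strict bound contradicts
      \<open>main\<close>, whose right-hand side is now
      \<open>\<omega> * c * (y - 1)\<close>.\<close>
    then have "\<omega> * c * (y - 1) < \<omega> * c * (q * (m * m powr q))"
      using strict \<omega> c_pos by (intro mult_strict_left_mono) auto
    then show False using main eq by simp
  qed
  then show "mass u = c" by (simp add: m)
qed

section \<open>The rescaled optimizer and the minimal values\<close>

lemma optimizer_in_H2: "v \<in> H2" and mass_v_pos: "0 < mass v"
  using v nonzero_iff_mass_pos[OF H2_in_L2, of v] by (auto simp: GN_optimizer_def)

lemma freq_pos: "0 < freq"
  using exponents mass_v_pos \<epsilon>_pos by (simp add: freq_def)

text \<open>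
  \<open>l\<close> makes the arithmetic-geometric mean inequality in \<open>potential_le\<close> an equality, and \<open>\<mu>\<close> adjusts the mass.
\<close>

lemma rescaled_optimizer:
  obtains w :: "real ^ 'n \<Rightarrow> real"
  where "w \<in> H2" "mass w = c" "energy \<epsilon> p w = 0" "freq * c = q * kinetic \<epsilon> w"
proof -
  define l where "l = sqrt (\<alpha> / (\<beta> * \<epsilon>))"
  define \<mu> where "\<mu> = sqrt (c * l ^ CARD('n) / mass v)"
  define w where "w x = \<mu> * v (l *\<^sub>R x)" for x
  have l: "0 < l" "l\<^sup>2 = \<alpha> / (\<beta> * \<epsilon>)" using exponents \<epsilon>_pos by (simp_all add: l_def)
  have \<mu>: "0 < \<mu>" "\<mu>\<^sup>2 = c * l ^ CARD('n) / mass v"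
    using l c_pos mass_v_pos by (simp_all add: \<mu>_def)
  have I: "(\<integral>x. (laplacian v x)\<^sup>2 \<partial>lborel) = 1" "(\<integral>x. (norm (grad v x))\<^sup>2 \<partial>lborel) = 1"
    using Lp_norm_2_square[of "laplacian v"] Lp_norm_2_square[of "grad v"] grad_v laplacian_v by simp_all
  have w: "w \<in> H2" unfolding w_def[abs_def] by (rule H2_dilation[OF optimizer_in_H2 l(1)])
  have M: "mass w = c"
    using mass_dilation[OF H2_in_L2[OF optimizer_in_H2] l(1), of \<mu>] \<mu> l mass_v_pos
    by (simp add: w_def[abs_def])
  have "kinetic \<epsilon> w = \<mu>\<^sup>2 * l\<^sup>2 * (\<epsilon> * l\<^sup>2 + 1) / l ^ CARD('n)"
    using kinetic_dilation[OF optimizer_in_H2 l(1), of \<epsilon> \<mu>] I by (simp add: w_def[abs_def] kinetic_def)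
  also have "\<dots> = c / mass v * l\<^sup>2 * (\<epsilon> * l\<^sup>2 + 1)"
    unfolding \<mu> using l(1) by simp
  \<comment> \<open>The choice of \<open>l\<close> gives the summands the ratio
    \<open>\<alpha>\<close> to \<open>\<beta>\<close>, and these sum to 1.\<close>
  also have "\<epsilon> * l\<^sup>2 + 1 = 1 / \<beta>"
    unfolding l using exponents \<epsilon>_pos by (simp add: field_simps)
  finally have X: "kinetic \<epsilon> w = c * l\<^sup>2 / (mass v * \<beta>)" by simp
  have "\<bar>\<mu>\<bar> powr p = (\<mu>\<^sup>2) powr (q + 1)"
    using \<mu>(1) exponents(5) by (simp add: powr_powr flip: powr_numeral)
  then have \<mu>p: "\<bar>\<mu>\<bar> powr p = (c * l ^ CARD('n) / mass v) powr q * (c * l ^ CARD('n) / mass v)"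
    unfolding \<mu> using c_pos l mass_v_pos by (simp add: powr_add)
  \<comment> \<open>This identity removes the dimension from the power of \<open>l\<close>: what
    remains is \<open>l\<^sup>2\<close> and a power that cancels against the constants of
    \<open>C_c_powr\<close>.\<close>
  have "real CARD('n) * q = 2 + 2 * \<alpha>" by (simp add: q_def \<alpha>_def field_simps)
  then have "(l ^ CARD('n)) powr q = l powr (2 + 2 * \<alpha>)"
    using l(1) by (simp add: powr_powr flip: powr_realpow)
  also have "\<dots> = l\<^sup>2 * (l\<^sup>2) powr \<alpha>"
    using l(1) by (simp add: powr_add powr_powr flip: powr_numeral)
  finally have lN: "(l ^ CARD('n)) powr q = l\<^sup>2 * (\<alpha> / (\<beta> * \<epsilon>)) powr \<alpha>" using l by simp
  \<comment> \<open>The interpolation inequality is an equality for \<open>v\<close>, and the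
    normalisation makes its gradient and Laplacian factors 1.\<close>
  have Pv: "potential p v = C * mass v powr q"
    using v Lp_norm_powr[of p v] p_gt_2 by (simp add: GN_optimizer_def GN_rhs_eq I potential_def)
  have "potential p w = (c * l ^ CARD('n) / mass v) powr q * (c * l ^ CARD('n) / mass v) * (C * mass v powr q) / l ^ CARD('n)"
    using potential_dilation[OF H2_in_L2[OF optimizer_in_H2] l(1), of p \<mu>]
    by (simp add: w_def[abs_def] \<mu>p Pv)
  also have "\<dots> = (C * c powr q) * (l ^ CARD('n)) powr q * (c / mass v)"
    using c_pos l(1) mass_v_pos by (simp add: powr_mult powr_divide)
  also have "\<dots> = p / 2 * \<epsilon> powr \<alpha> / (\<alpha> powr \<alpha> * \<beta> powr \<beta>) * (l\<^sup>2 * (\<alpha> powr \<alpha> / (\<beta> powr \<alpha> * \<epsilon> powr \<alpha>))) * (c / mass v)"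
    unfolding C_c_powr lN using exponents \<epsilon>_pos by (simp add: powr_mult powr_divide)
  also have "\<dots> = p / 2 * (c * l\<^sup>2 / (mass v * (\<beta> powr \<beta> * \<beta> powr \<alpha>)))"
    using exponents \<epsilon>_pos by (simp add: mult_ac)
  also have "\<beta> powr \<beta> * \<beta> powr \<alpha> = \<beta>"
    using exponents by (simp add: add.commute flip: powr_add)
  finally have P: "potential p w = p / 2 * kinetic \<epsilon> w" by (simp add: X)
  show ?thesis
  proof
    show "w \<in> H2" "mass w = c" by fact+
    show "energy \<epsilon> p w = 0" using P p_gt_2 by (simp add: energy_eq)
    show "freq * c = q * kinetic \<epsilon> w"
      unfolding X l(2) freq_def by (simp add: power2_eq_square mult_ac)
  qed
qed

lemma potential_if_energy_eq_0: "energy \<epsilon> p (u :: real ^ 'n \<Rightarrow> real) = 0 \<Longrightarrow> potential p u = p / 2 * kinetic \<epsilon> u"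
  using p_gt_2 by (simp add: energy_eq field_simps)

lemma min_energy_eq: "min_energy TYPE('n) \<epsilon> p c = 0"
proof -
  obtain w :: "real ^ 'n \<Rightarrow> real" where w: "w \<in> H2" "mass w = c" "energy \<epsilon> p w = 0"
    using rescaled_optimizer by metis
  have "min_energy TYPE('n) \<epsilon> p c = ereal (energy \<epsilon> p w)"
    unfolding min_energy_def using w energy_nonneg
    by (intro INF_ereal_attained) (auto simp: mass_sphere_iff)
  then show ?thesis using w by (simp add: zero_ereal_def)
qed

lemma min_action_eq: "min_action TYPE('n) \<epsilon> p freq = ereal (freq * c / 2)"
proof -
  obtain w :: "real ^ 'n \<Rightarrow> real"
    where w: "w \<in> H2" "mass w = c" "energy \<epsilon> p w = 0" "freq * c = q * kinetic \<epsilon> w"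
    using rescaled_optimizer by metis
  \<comment> \<open>Zero energy makes the potential \<open>q + 1\<close> times the kinetic energy,
    and the surplus \<open>q * kinetic \<epsilon> w\<close> is \<open>freq * c\<close>.\<close>
  have "potential p w = kinetic \<epsilon> w + freq * mass w"
    using potential_if_energy_eq_0[OF w(3), unfolded half_p] w by (simp add: algebra_simps)
  then have "w \<in> nehari \<epsilon> p freq" using w c_pos p_gt_2 by (simp add: nehari_iff)
  moreover have act: "action \<epsilon> p freq w = freq * c / 2" using w by (simp add: action_eq)
  ultimately have "min_action TYPE('n) \<epsilon> p freq = ereal (action \<epsilon> p freq w)"
    unfolding min_action_def using action_lower_bound(1)[OF freq_pos]
    by (intro INF_ereal_attained) (simp_all add: act)
  then show ?thesis by (simp only: act)
qed

text \<open>Equality holds for \<open>u\<close> in \<open>potential_le\<close>, so \<open>u\<close>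
  minimises the difference of the two sides over \<open>H2\<close>. The first-order condition has
  the multiplier \<open>q * kinetic \<epsilon> u / c\<close>.\<close>

lemma Euler_Lagrange:
  fixes u :: "real ^ 'n \<Rightarrow> real"
  assumes u: "u \<in> H2" "mass u = c" and P: "potential p u = p / 2 * kinetic \<epsilon> u"
    and \<omega>: "\<omega> * c = q * kinetic \<epsilon> u"
  shows "lagrange_multiplier \<epsilon> p \<omega> u"
  unfolding lagrange_multiplier_def
proof (intro conjI ballI)
  fix \<phi> :: "real ^ 'n \<Rightarrow> real" assume \<phi>: "\<phi> \<in> H2"
  \<comment> \<open>By convexity it suffices to linearise the potential, so that it need not be differentiated
    under the integral sign.\<close>
  define X where "X = kinetic \<epsilon> u"
  define a where "a = \<epsilon> * (\<integral>x. laplacian u x * laplacian \<phi> x \<partial>lborel) + (\<integral>x. grad u x \<bullet> grad \<phi> x \<partial>lborel)"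
  define b where "b = (\<integral>x. u x * \<phi> x \<partial>lborel)"
  define J where "J = (\<integral>x. \<bar>u x\<bar> powr (p - 2) * u x * \<phi> x \<partial>lborel)"
  \<comment> \<open>The difference of the two sides of \<open>potential_le\<close> along
    \<open>u + t * \<phi>\<close>, with the potential replaced by its tangent at
    \<open>t = 0\<close>. It dominates the true difference, agrees with it at 0 and is explicit in
    \<open>t\<close>.\<close>
  define G where "G t = D * (X + 2 * t * a + t\<^sup>2 * kinetic \<epsilon> \<phi>) * (c + 2 * t * b + t\<^sup>2 * mass \<phi>) powr q
    - potential p u - t * p * J" for t
  have G_nonneg: "0 \<le> G t" for t
  proof -
    let ?w = "\<lambda>x. u x + t * \<phi> x"
    have w: "?w \<in> H2" by (rule H2_lincomb(1)[OF u(1) \<phi>])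
    have "potential p u + t * p * J \<le> potential p ?w"
      unfolding J_def using p_gt_2 w \<phi> u by (intro potential_above_tangent H2_in_Lp) auto
    also have "\<dots> \<le> D * kinetic \<epsilon> ?w * mass ?w powr q" by (rule potential_le[OF w])
    finally show ?thesis
      using kinetic_lincomb[OF u(1) \<phi>, of \<epsilon> t] mass_lincomb[OF u(1)[THEN H2_in_L2] \<phi>[THEN H2_in_L2], of t] u(2)
      by (simp add: G_def X_def a_def b_def)
  qed
  have "D * X * c powr q = (D * c powr q) * X" by simp
  then have G0: "G 0 = 0" unfolding D_c_powr by (simp add: G_def P X_def)
  have cq: "c powr q * (1 / c) = c powr (q - 1)" using c_pos by (simp add: powr_diff)
  have "(G has_real_derivative D * (2 * a * c powr q + X * (q * c powr (q - 1) * (2 * b))) - p * J) (at 0)"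
    unfolding G_def using c_pos by (auto intro!: derivative_eq_intros simp: algebra_simps)
  \<comment> \<open>0 is a global minimum point of \<open>G\<close>, so the radius 1 is
    arbitrary.\<close>
  then have "D * (2 * a * c powr q + X * (q * c powr (q - 1) * (2 * b))) - p * J = 0"
    by (rule DERIV_local_min[where d = 1]) (use G_nonneg G0 in auto)
  moreover have "D * (2 * a * c powr q + X * (q * c powr (q - 1) * (2 * b)))
      = (D * c powr q) * (2 * a + q * X / c * (2 * b))"
    unfolding cq[symmetric] by (simp add: algebra_simps)
  ultimately have "p * (a + q * X / c * b) = p * J"
    unfolding D_c_powr by (simp add: algebra_simps)
  moreover have "q * X / c = \<omega>" using \<omega> c_pos by (simp add: X_def field_simps)
  ultimately have "a + \<omega> * b = J" using p_gt_2 by simp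
  then show "\<epsilon> * (\<integral>x. laplacian u x * laplacian \<phi> x \<partial>lborel) + (\<integral>x. grad u x \<bullet> grad \<phi> x \<partial>lborel)
      + \<omega> * (\<integral>x. u x * \<phi> x \<partial>lborel) = (\<integral>x. \<bar>u x\<bar> powr (p - 2) * u x * \<phi> x \<partial>lborel)"
    by (simp add: a_def b_def J_def)
qed (rule u(1))

theorem energy_GSS_iff_action_GSS:
  fixes u :: "real ^ 'n \<Rightarrow> real"
  shows "energy_GSS \<epsilon> p c u \<and> lagrange_multiplier \<epsilon> p freq u \<longleftrightarrow> action_GSS \<epsilon> p freq u"
proof
  assume L: "energy_GSS \<epsilon> p c u \<and> lagrange_multiplier \<epsilon> p freq u"
  then have u: "u \<in> H2" "mass u = c" "energy \<epsilon> p u = 0"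
    by (auto simp: energy_GSS_def mass_sphere_iff min_energy_eq)
  have "u \<in> nehari \<epsilon> p freq"
    using u c_pos p_gt_2 lagrange_multiplier_test_self[of \<epsilon> p freq u] L by (simp add: nehari_iff)
  then show "action_GSS \<epsilon> p freq u"
    using u by (simp add: action_GSS_def min_action_eq action_eq)
next
  assume "action_GSS \<epsilon> p freq u"
  then have n: "u \<in> nehari \<epsilon> p freq" and act: "action \<epsilon> p freq u = freq * c / 2"
    by (auto simp: action_GSS_def min_action_eq)
  have M: "mass u = c" by (rule action_lower_bound(2)[OF freq_pos n act])
  then have E: "energy \<epsilon> p u = 0" using act by (simp add: action_eq)
  have u: "u \<in> H2" "potential p u = kinetic \<epsilon> u + freq * c"
    using n M p_gt_2 by (auto simp: nehari_iff)
  have P: "potential p u = p / 2 * kinetic \<epsilon> u" by (rule potential_if_energy_eq_0[OF E])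
  then have "freq * c = q * kinetic \<epsilon> u" unfolding half_p using u(2) by (simp add: algebra_simps)
  then show "energy_GSS \<epsilon> p c u \<and> lagrange_multiplier \<epsilon> p freq u"
    using u M E P Euler_Lagrange by (simp add: energy_GSS_def mass_sphere_iff min_energy_eq)
qed

end

theorem theorem1p3:
  fixes N :: nat and p \<epsilon> C \<omega> :: real and v u :: "real ^ 'n \<Rightarrow> real"
  assumes "N = CARD('n)"
    and "2 + 4 / real N < p" and "p < 2 + 8 / real N"
    and "0 < \<epsilon>"
    and "GN_best_constant TYPE('n) p C"
    and "GN_optimizer p C v"
    and "Lp_norm 2 (grad v) = 1" and "Lp_norm 2 (laplacian v) = 1"
    and "\<omega> = (p - 2) * ((real N * (p - 2) - 4) / 2) * ((8 - real N * (p - 2)) / 2) powi (- 2)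
               * Lp_norm 2 v powi (- 2) * inverse \<epsilon>"
  shows "energy_GSS \<epsilon> p (critical_mass N p C \<epsilon>) u \<and> lagrange_multiplier \<epsilon> p \<omega> u
         \<longleftrightarrow> action_GSS \<epsilon> p \<omega> u"
proof -
  have N: "0 < real N" using assms(1) by simp
  \<comment> \<open>The bounds on \<open>p\<close> are multiplied by the positive dimension.\<close>
  interpret GN_setting p \<epsilon> C v
    using assms N by unfold_locales (auto simp: field_simps GN_best_constant_def)
  have "Lp_norm 2 v powi (- 2) = inverse (mass v)"
    using Lp_norm_2_square[of v] by (simp add: mass_def power_int_minus)
  moreover have "(real N * (p - 2) - 4) / 2 = 2 * \<alpha>" "(8 - real N * (p - 2)) / 2 = 2 * \<beta>"
    by (simp_all add: \<alpha>_def \<beta>_def assms(1))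
  moreover have "(2 * \<beta>) powi (- 2) = inverse (4 * \<beta>\<^sup>2)" "p - 2 = 2 * q"
    by (simp_all add: power_int_minus power_mult_distrib q_def)
  \<comment> \<open>The numerical factors cancel, since \<open>2 * 2 / 4 = 1\<close>.\<close>
  ultimately have "\<omega> = 2 * q * (2 * \<alpha>) * inverse (4 * \<beta>\<^sup>2) * inverse (mass v) * inverse \<epsilon>"
    using assms(9) by (simp only:)
  then have "\<omega> = freq" by (simp add: freq_def field_simps)
  then show ?thesis
    using energy_GSS_iff_action_GSS[of u] assms(1) by (simp add: c_def)
qed

end
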